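(* Let $H$, $K$ be complex Hilbert spaces with $n=\dim H\le m=\dim K<\infty$. (1) The set of separable states of $\mathcal B(K\otimes H)$ of rank $mn$ contains a nonempty relatively open subset of the state space of $\mathcal B(K\otimes H)$. (2) Assume moreover $n\ge 2$. For every faithful state $\omega$ of $\mathcal B(H)$, the set of entangled states of $E^{mn}(\omega)$ is a relatively open subset of $E^{mn}(\omega)$ that is neither empty nor dense in $E^{mn}(\omega)$, and its $P^{mn,\omega}$-probability $p$ satisfies $0<p<1$.
   Context: A state $\rho$ of $\mathcal B(K\otimes H)\cong\mathcal B(K)\otimes\mathcal B(H)$ is separable if it is a convex combination of product states $\sigma\otimes\tau$, with $\sigma$ a state of $\mathcal B(K)$ and $\tau$ a state of $\mathcal B(H)$; otherwise it is entangled. The rank of a state is the rank of its density operator. For $1\le r\le mn$, $E^r(\omega)$ is the set of states $\rho$ of $\mathcal B(K\otimes H)$ of rank $\le r$ with $\rho(\mathbf 1_K\otimes b)=\omega(b)$ for all $b\in\mathcal B(H)$; so $E^{mn}(\omega)$ is the set of all extensions of $\omega$. $V^r(H,K)$ is the space of all $r$-tuples $v=(v_1,\dots,v_r)$ with $v_k\in\mathcal B(H,K)$ and $v_1^*v_1+\cdots+v_r^*v_r=\mathbf 1_H$. The unitary group $\mathcal U(r\cdot K)$ of the direct sum $r\cdot K$ of $r$ copies of $K$ (unitary $r\times r$ matrices $(w_{ij})$ with entries in $\mathcal B(K)$) acts transitively on $V^r(H,K)$ by $(w\cdot v)_i=\sum_j w_{ij}v_j$; let $\mu$ be the unique Borel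 probability measure on $V^r(H,K)$ invariant under this action. Fix a vector $\xi_\omega\in H\otimes H$ with $(\mathbf 1_H\otimes\mathcal B(H))\xi_\omega=H\otimes H$ and $\omega(b)=\langle(\mathbf 1_H\otimes b)\xi_\omega,\xi_\omega\rangle$ for $b\in\mathcal B(H)$ (such a vector exists since $\omega$ is faithful). For $v\in V^r(H,K)$ let $\rho_v(x)=\sum_{k=1}^r\langle x(v_k\otimes\mathbf 1_H)\xi_\omega,(v_k\otimes\mathbf 1_H)\xi_\omega\rangle$, $x\in\mathcal B(K\otimes H)$; then $\rho_v\in E^r(\omega)$. $P^{r,\omega}$ is the push-forward of $\mu$ under the map $v\mapsto\rho_v$ from $V^r(H,K)$ to $E^r(\omega)$ (it does not depend on the choice of $\xi_\omega$). *)

theory Defs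
  imports "HOL-Probability.Probability"
begin

text \<open>
  The Hilbert space of dimension \<open>CARD('a)\<close> is \<open>complex ^ 'a\<close>, and the operators from
  \<open>complex ^ 'a\<close> to \<open>complex ^ 'b\<close> are the matrices \<open>complex ^ 'a ^ 'b\<close>.  The tensor product of
  \<open>complex ^ 'a\<close> and \<open>complex ^ 'b\<close> is \<open>complex ^ ('a \<times> 'b)\<close>.  A state is a functional on the
  operators, not a matrix.  Sets of states carry the topology of pointwise convergence (the product topology
  of the function space), which in finite dimension is the norm topology on linear functionals.
\<close>

definition cip :: "complex ^ 'a \<Rightarrow> complex ^ 'a \<Rightarrow> complex" where
  "cip x y = (\<Sum>i\<in>UNIV. x $ i * cnj (y $ i))"

definition adj :: "complex ^ 'a ^ 'b \<Rightarrow> complex ^ 'b ^ 'a" where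
  "adj x = (\<chi> i j. cnj (x $ j $ i))"

definition otimes :: "complex ^ 'a ^ 'b \<Rightarrow> complex ^ 'c ^ 'd \<Rightarrow> complex ^ ('a \<times> 'c) ^ ('b \<times> 'd)"
  (infixr "\<otimes>" 75) where
  "a \<otimes> b = (\<chi> p q. a $ fst p $ fst q * b $ snd p $ snd q)"

definition is_state :: "(complex ^ 'a ^ 'a \<Rightarrow> complex) \<Rightarrow> bool" where
  "is_state \<phi> \<longleftrightarrow>
     (\<forall>x y. \<phi> (x + y) = \<phi> x + \<phi> y) \<and>
     (\<forall>c x. \<phi> (\<chi> i j. c * x $ i $ j) = c * \<phi> x) \<and>
     (\<forall>x :: complex ^ 'a ^ 'a. \<phi> (adj x ** x) \<in> \<real>\<^sub>\<ge>\<^sub>0) \<and>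
     \<phi> (mat 1) = 1"

definition state_space :: "(complex ^ 'a ^ 'a \<Rightarrow> complex) set" where
  "state_space = {\<phi>. is_state \<phi>}"

definition faithful :: "(complex ^ 'a ^ 'a \<Rightarrow> complex) \<Rightarrow> bool" where
  "faithful \<phi> \<longleftrightarrow> (\<forall>x :: complex ^ 'a ^ 'a. \<phi> (adj x ** x) = 0 \<longrightarrow> x = 0)"

text \<open>The trace pairing is nondegenerate, so every linear functional has exactly one density.\<close>

definition density :: "(complex ^ 'a ^ 'a \<Rightarrow> complex) \<Rightarrow> complex ^ 'a ^ 'a" where
  "density \<phi> = (THE d. \<forall>x. \<phi> x = trace (d ** x))"

definition state_rank :: "(complex ^ 'a ^ 'a \<Rightarrow> complex) \<Rightarrow> nat" where
  "state_rank \<phi> = rank (density \<phi>)"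

text \<open>Elementary tensors span, so the condition on them determines the state \<open>\<rho>\<close> as \<open>\<sigma> \<otimes> \<tau>\<close>.\<close>

definition product_states ::
    "(complex ^ ('k::finite \<times> 'h::finite) ^ ('k \<times> 'h) \<Rightarrow> complex) set" where
  "product_states = {\<rho>. is_state \<rho> \<and>
     (\<exists>\<sigma> \<tau>. is_state \<sigma> \<and> is_state \<tau> \<and>
        (\<forall>(a :: complex ^ 'k ^ 'k) (b :: complex ^ 'h ^ 'h). \<rho> (a \<otimes> b) = \<sigma> a * \<tau> b))}"

definition separable_state :: "(complex ^ ('k::finite \<times> 'h::finite) ^ ('k \<times> 'h) \<Rightarrow> complex) \<Rightarrow> bool" where
  "separable_state \<rho> \<longleftrightarrow> is_state \<rho> \<and>
     (\<exists>(N::nat) (t :: nat \<Rightarrow> real) \<pi>.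
        (\<forall>i<N. 0 \<le> t i \<and> \<pi> i \<in> product_states) \<and> (\<Sum>i<N. t i) = 1 \<and>
        (\<forall>x. \<rho> x = (\<Sum>i<N. complex_of_real (t i) * \<pi> i x)))"

definition entangled :: "(complex ^ ('k::finite \<times> 'h::finite) ^ ('k \<times> 'h) \<Rightarrow> complex) \<Rightarrow> bool" where
  "entangled \<rho> \<longleftrightarrow> is_state \<rho> \<and> \<not> separable_state \<rho>"

definition extensions ::
    "nat \<Rightarrow> (complex ^ 'h ^ 'h \<Rightarrow> complex) \<Rightarrow> (complex ^ ('k::finite \<times> 'h::finite) ^ ('k \<times> 'h) \<Rightarrow> complex) set" where
  "extensions r \<omega> = {\<rho>. is_state \<rho> \<and> state_rank \<rho> \<le> r \<and>
     (\<forall>b. \<rho> ((mat 1 :: complex ^ 'k ^ 'k) \<otimes> b) = \<omega> b)}"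

text \<open>The \<open>r\<close>-tuples are indexed by a finite type \<open>'r\<close> with \<open>r = CARD('r)\<close>.\<close>

definition tuple_space :: "(complex ^ 'h ^ 'k ^ 'r) set" where
  "tuple_space = {v. (\<Sum>k\<in>UNIV. adj (v $ k) ** (v $ k)) = mat 1}"

definition block_unitary :: "complex ^ 'k ^ 'k ^ 'r ^ 'r \<Rightarrow> bool" where
  "block_unitary w \<longleftrightarrow>
     (\<forall>i j. (\<Sum>k\<in>UNIV. adj (w $ k $ i) ** (w $ k $ j)) = (if i = j then mat 1 else 0)) \<and>
     (\<forall>i j. (\<Sum>k\<in>UNIV. (w $ i $ k) ** adj (w $ j $ k)) = (if i = j then mat 1 else 0))"

definition block_act :: "complex ^ 'k ^ 'k ^ 'r ^ 'r \<Rightarrow> complex ^ 'h ^ 'k ^ 'r \<Rightarrow> complex ^ 'h ^ 'k ^ 'r" where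
  "block_act w v = (\<chi> i. \<Sum>j\<in>UNIV. (w $ i $ j) ** (v $ j))"

text \<open>The unitary group acts transitively on \<open>tuple_space\<close>, so exactly one measure satisfies the
  following predicate when \<open>tuple_space\<close> is nonempty.\<close>

definition invariant_prob :: "(complex ^ 'h ^ 'k ^ 'r) measure \<Rightarrow> bool" where
  "invariant_prob \<mu> \<longleftrightarrow>
     space \<mu> = tuple_space \<and> sets \<mu> = sets (restrict_space borel tuple_space) \<and>
     prob_space \<mu> \<and> (\<forall>w. block_unitary w \<longrightarrow> distr \<mu> \<mu> (block_act w) = \<mu>)"

definition represents :: "complex ^ ('h::finite \<times> 'h) \<Rightarrow> (complex ^ 'h ^ 'h \<Rightarrow> complex) \<Rightarrow> bool" where
  "represents \<xi> \<omega> \<longleftrightarrow>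
     range (\<lambda>b :: complex ^ 'h ^ 'h. ((mat 1 :: complex ^ 'h ^ 'h) \<otimes> b) *v \<xi>) = UNIV \<and>
     (\<forall>b. \<omega> b = cip (((mat 1 :: complex ^ 'h ^ 'h) \<otimes> b) *v \<xi>) \<xi>)"

definition rho ::
    "complex ^ ('h::finite \<times> 'h) \<Rightarrow> complex ^ 'h ^ 'k ^ 'r \<Rightarrow>
     complex ^ ('k::finite \<times> 'h) ^ ('k \<times> 'h) \<Rightarrow> complex" where
  "rho \<xi> v x =
     (\<Sum>k\<in>UNIV. cip (x *v ((v $ k \<otimes> (mat 1 :: complex ^ 'h ^ 'h)) *v \<xi>))
                     ((v $ k \<otimes> (mat 1 :: complex ^ 'h ^ 'h)) *v \<xi>))"

definition P_ext ::
    "(complex ^ 'h ^ 'k ^ 'r) measure \<Rightarrow> complex ^ ('h::finite \<times> 'h) \<Rightarrow> (complex ^ 'h ^ 'h \<Rightarrow> complex) \<Rightarrow>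
     (complex ^ ('k::finite \<times> 'h::finite) ^ ('k \<times> 'h) \<Rightarrow> complex) measure" where
  "P_ext \<mu> \<xi> \<omega> = distr \<mu> (restrict_space borel (extensions CARD('r) \<omega>)) (rho \<xi>)"

end

theory Submission
  imports Defs
begin

text \<open>
  States correspond to positive matrices of trace one, and separable states to the convex hull of the
  compact set of product densities; this hull is closed, so being entangled is an open condition.
  The cone of separable matrices contains \<open>\<epsilon> 1 + X\<close> for every Hermitian \<open>X\<close> that is
  small compared with \<open>\<epsilon>\<close>. Hence every density that exceeds a separable matrix by a positive
  multiple of the identity is interior to the separable states. This applies to the tracial state
  and, as \<open>\<omega>\<close> is faithful, to the product of the tracial state with \<open>\<omega>\<close>, which is
  \<open>\<rho>\<^sub>v\<close> for the tuple of all matrix units divided by the square root of \<open>m\<close>. In the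
  other direction, an isometry \<open>H \<rightarrow> K\<close>, padded with zeros, gives a pure \<open>\<rho>\<^sub>v\<close> whose vector
  has Schmidt rank \<open>n \<ge> 2\<close>, and this state is entangled. Finally, the unitary group acts
  transitively on the compact space of tuples, so finitely many translates of any nonempty open set
  cover it and the invariant measure of that set is positive.
\<close>

section \<open>Positive semidefinite matrices and states\<close>

text \<open>Interior points are handled quantitatively, through a margin: a number \<epsilon> > 0
  with \<open>d - \<epsilon> *\<^sub>R mat 1 \<in> sepcone\<close>. Half of the margin survives in a
  whole neighbourhood, and there it gives separability and full rank at once. That the identity is
  interior to the cone needs an argument, since a product vector cannot produce a single
  off-diagonal matrix unit together with its adjoint; giving opposite phases to the two tensor
  factors and averaging cancels everything else off the diagonal. Neighbourhoods live in the space
  of functionals with pointwise convergence, while compactness and cones concern matrices.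
  Evaluation at matrix units is the continuous bridge between the two. In the probability claim only
  the invariance of the measure is available, not a formula for it. Positivity on open sets
  therefore has to come from transitivity, which is proved by moving one column of the tuple at a
  time with a complex reflection.\<close>

lemma cip_add_left: "cip (x + y) z = cip x z + cip y z"
  by (simp add: cip_def algebra_simps sum.distrib)

lemma cip_add_right: "cip z (x + y) = cip z x + cip z y"
  by (simp add: cip_def algebra_simps sum.distrib)

lemma cip_scale_left: "cip (c *s x) y = c * cip x y"
  by (simp add: cip_def sum_distrib_left mult.assoc)

lemma cip_scale_right: "cip x (c *s y) = cnj c * cip x y"
  by (simp add: cip_def sum_distrib_left ac_simps)

lemma cip_diff_left: "cip (x - y) z = cip x z - cip y z"
  by (simp add: cip_def algebra_simps sum_subtractf)

lemma cip_diff_right: "cip z (x - y) = cip z x - cip z y"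
  by (simp add: cip_def algebra_simps sum_subtractf)

lemma cip_zero [simp]: "cip 0 x = 0" "cip x 0 = 0"
  by (simp_all add: cip_def)

lemma cnj_cip: "cnj (cip x y) = cip y x"
  by (simp add: cip_def mult.commute)

lemma cip_self: "cip x x = complex_of_real ((norm x)\<^sup>2)"
proof -
  have "cip x x = (\<Sum>i\<in>UNIV. complex_of_real ((norm (x $ i))\<^sup>2))"
    unfolding cip_def by (simp only: complex_norm_square)
  also have "\<dots> = complex_of_real ((norm x)\<^sup>2)"
    by (simp add: norm_vec_def L2_set_def sum_nonneg)
  finally show ?thesis .
qed

lemma cip_self_eq_0: "cip x x = 0 \<longleftrightarrow> x = 0"
  by (simp add: cip_self)

lemma cip_axis_right [simp]: "cip x (axis q 1) = x $ q"
proof -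
  have "cip x (axis q 1) = (\<Sum>i\<in>UNIV. if i = q then x $ i else 0)"
    unfolding cip_def by (intro sum.cong refl) (simp add: axis_def)
  then show ?thesis by simp
qed

lemma cip_axis_left [simp]: "cip (axis q 1) x = cnj (x $ q)"
  by (metis cip_axis_right cnj_cip)

lemma matrix_vector_axis_component: "(d *v axis p 1) $ q = (d :: complex^'a^'b) $ q $ p"
  by (simp add: matrix_vector_mult_def axis_def if_distrib cong: if_cong)

lemma matrix_vector_scale: "d *v (c *s y) = c *s (d *v y)" for d :: "complex^'a^'b"
  by (vector matrix_vector_mult_def sum_distrib_left ac_simps)

definition psd :: "complex ^ 'a ^ 'a \<Rightarrow> bool" where
  "psd d \<longleftrightarrow> (\<forall>y. cip (d *v y) y \<in> \<real>\<^sub>\<ge>\<^sub>0)"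

text \<open>Polarization: the form is real at x + y, which compares imaginary parts, and at \<i> x +
  y, which compares real parts.\<close>

lemma psd_selfadjoint:
  assumes "psd d"
  shows "cip (d *v x) y = cip x (d *v y)"
proof -
  have q: "Im (cip (d *v z) z) = 0" for z
    using assms by (auto simp: psd_def complex_nonneg_Reals_iff)
  have "Im (cip (d *v x) y) = - Im (cip (d *v y) x)"
    using q[of "x + y"] q[of x] q[of y]
    by (simp add: matrix_vector_right_distrib cip_add_left cip_add_right)
  moreover have "Re (cip (d *v x) y) = Re (cip (d *v y) x)"
    using q[of "\<i> *s x + y"] q[of "\<i> *s x"] q[of y]
    by (simp add: matrix_vector_right_distrib cip_add_left cip_add_right
        matrix_vector_scale cip_scale_left cip_scale_right del: vector_smult_assoc)
  ultimately have "cip (d *v x) y = cnj (cip (d *v y) x)"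
    by (simp add: complex_eq_iff)
  then show ?thesis by (simp add: cnj_cip)
qed

lemma psd_hermitian:
  assumes "psd d"
  shows "cnj (d $ p $ q) = d $ q $ p"
  using psd_selfadjoint[OF assms, of "axis p 1" "axis q 1"]
  by (simp add: matrix_vector_axis_component)

lemma cip_sum_left: "cip (\<Sum>i\<in>A. f i) y = (\<Sum>i\<in>A. cip (f i) y)"
  by (induction A rule: infinite_finite_induct) (auto simp: cip_add_left)

text \<open>With z = d y, the form at z + t y has no term in t squared, so it is affine in t with
  slope 2 N, where N is the squared norm of z. An affine function bounded below on the whole real
  line is constant, so N = 0.\<close>

lemma psd_eq_0:
  assumes d: "psd d" and y: "cip (d *v y) y = 0"
  shows "d *v y = 0"
proof (rule ccontr)
  define z where "z = d *v y"
  define N where "N = (norm z)\<^sup>2"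
  assume "d *v y \<noteq> 0"
  then have N: "N > 0" by (simp add: N_def z_def)
  define Q where "Q = Re (cip (d *v z) z)"
  have zz: "cip z z = of_real N" by (simp add: cip_self N_def)
  have *: "Q + 2 * t * N \<ge> 0" for t :: real
  proof -
    have "cip (d *v (z + of_real t *s y)) (z + of_real t *s y) \<in> \<real>\<^sub>\<ge>\<^sub>0"
      using d by (simp add: psd_def)
    moreover have "cip (d *v z) y = cip z z" "cip (d *v y) z = cip z z"
      by (simp_all add: psd_selfadjoint[OF d] z_def)
    ultimately show ?thesis
      by (simp add: matrix_vector_right_distrib cip_add_left cip_add_right y zz Q_def
        matrix_vector_scale cip_scale_left cip_scale_right complex_nonneg_Reals_iff ac_simps)
  qed
  have "2 * (- (\<bar>Q\<bar> + 1) / N) * N = - 2 * (\<bar>Q\<bar> + 1)"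
    using N by simp
  with *[of "- (\<bar>Q\<bar> + 1) / N"] have "Q - 2 * (\<bar>Q\<bar> + 1) \<ge> 0"
    by simp
  then show False
    by (simp add: abs_if split: if_splits)
qed

definition outer :: "complex ^ 'a \<Rightarrow> complex ^ 'a ^ 'a" where
  "outer y = (\<chi> i j. y $ i * cnj (y $ j))"

lemma outer_mult: "outer u *v y = cip y u *s u"
  by (vector matrix_vector_mult_def outer_def cip_def sum_distrib_left sum_distrib_right ac_simps)

lemma psd_outer [simp]: "psd (outer u)"
proof -
  have "cip (outer u *v y) y = of_real ((cmod (cip y u))\<^sup>2)" for y
    by (metis outer_mult cip_scale_left cnj_cip complex_norm_square)
  then show ?thesis by (simp add: psd_def)
qed

lemma matrix_vector_sum: "(\<Sum>i\<in>A. f i) *v y = (\<Sum>i\<in>A. f i *v y)" for f :: "'i \<Rightarrow> complex^'a^'b"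
  by (induction A rule: infinite_finite_induct) (auto simp: matrix_vector_mult_add_rdistrib)

lemma matrix_vector_scaleR_left: "(c *\<^sub>R d) *v y = of_real c *s (d *v y)" for d :: "complex^'a^'b"
  by (vector matrix_vector_mult_def sum_distrib_left scaleR_conv_of_real ac_simps)

lemma psd_add: "psd a \<Longrightarrow> psd b \<Longrightarrow> psd (a + b)"
  by (auto simp: psd_def matrix_vector_mult_add_rdistrib cip_add_left intro: nonneg_Reals_add_I)

lemma psd_scaleR: "0 \<le> c \<Longrightarrow> psd a \<Longrightarrow> psd (c *\<^sub>R a)"
  by (auto simp: psd_def matrix_vector_scaleR_left cip_scale_left intro!: nonneg_Reals_mult_I)

lemma psd_0 [simp]: "psd 0"
  by (simp add: psd_def)

lemma psd_sum: "(\<And>i. i \<in> A \<Longrightarrow> psd (f i)) \<Longrightarrow> psd (\<Sum>i\<in>A. f i)"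
  by (induction A rule: infinite_finite_induct) (auto intro: psd_add)

text \<open>A Schur complement step in direction \<open>e\<close>. The last conclusion says that the
  kernel only grows, so columns that have been removed stay removed when the step is
  iterated.\<close>

lemma psd_subtract_column:
  assumes d: "psd d"
  obtains u where "psd (d - outer u)" "(d - outer u) *v e = 0"
    and "\<And>x. d *v x = 0 \<Longrightarrow> (d - outer u) *v x = 0"
proof (cases "cip (d *v e) e = 0")
  case True
  have "outer 0 = (0 :: complex^'a^'a)" by (vector outer_def)
  then show ?thesis using that[of 0] d psd_eq_0[OF d True] by simp
next
  case False
  define z where "z = d *v e"
  define r where "r = Re (cip z e)"
  have zr: "cip z e = of_real r" and r: "r > 0"
  proof -
    have "cip z e \<in> \<real>\<^sub>\<ge>\<^sub>0" using d by (simp add: psd_def z_def)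
    then show "cip z e = of_real r" by (simp add: r_def complex_nonneg_Reals_iff complex_eq_iff)
    moreover have "r \<ge> 0"
      using \<open>cip z e \<in> \<real>\<^sub>\<ge>\<^sub>0\<close> by (simp add: complex_nonneg_Reals_iff r_def)
    ultimately show "r > 0"
      using False by (cases "r = 0") (auto simp: z_def)
  qed
  have ez: "cip e z = of_real r" by (metis cnj_cip complex_cnj_complex_of_real zr)
  \<comment> \<open>The scaling makes \<open>outer u\<close> send \<open>e\<close> to z = d e, so
    the difference kills \<open>e\<close>.\<close>
  define u where "u = of_real (1 / sqrt r) *s z"
  have ou: "outer u *v y = (cip y z / of_real r) *s z" for y
  proof -
    have "outer u *v y = (of_real (1 / sqrt r * (1 / sqrt r)) * cip y z) *s z"
      unfolding outer_mult u_def cip_scale_right vector_smult_assoc of_real_mult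
      by (simp only: complex_cnj_complex_of_real ac_simps)
    also have "1 / sqrt r * (1 / sqrt r) = 1 / r"
      using r by simp
    finally show ?thesis by simp
  qed
  have sub: "(d - outer u) *v y = d *v y - (cip y z / of_real r) *s z" for y
    by (simp add: ou matrix_vector_mult_diff_rdistrib)
  show ?thesis
  proof
    show "(d - outer u) *v e = 0"
      using r unfolding sub ez by (simp add: z_def)
    show "(d - outer u) *v x = 0" if "d *v x = 0" for x
      using that psd_selfadjoint[OF d, of x e] by (simp add: sub z_def)
    show "psd (d - outer u)"
      unfolding psd_def
    proof
      fix y
      \<comment> \<open>\<open>c *s e\<close> is the component of y along \<open>e\<close> for the
        semi-inner product of d. The form of \<open>d - outer u\<close> at y is the form of d at
        what remains of y.\<close>
      define c where "c = cip y z / of_real r"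
      have "cip (d *v (y - c *s e)) (y - c *s e) \<in> \<real>\<^sub>\<ge>\<^sub>0"
        using d by (simp add: psd_def)
      moreover have "cip (d *v (y - c *s e)) (y - c *s e) = cip ((d - outer u) *v y) y"
      proof -
        have dye: "cip (d *v y) e = cip y z" by (simp add: psd_selfadjoint[OF d] z_def)
        have "d *v (y - c *s e) = d *v y - c *s z"
          by (simp add: matrix_vector_mult_diff_distrib matrix_vector_scale z_def)
        then have "cip (d *v (y - c *s e)) (y - c *s e) =
            cip (d *v y) y - cnj c * cip y z - (c * cip z y - c * (cnj c * of_real r))"
          by (simp add: cip_diff_left cip_diff_right cip_scale_left cip_scale_right dye zr right_diff_distrib)
        also have "\<dots> = cip (d *v y) y - c * cip z y"
          using r by (simp add: c_def)
        also have "\<dots> = cip ((d - outer u) *v y) y"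
          by (simp add: sub cip_diff_left cip_scale_left c_def)
        finally show ?thesis .
      qed
      ultimately show "cip ((d - outer u) *v y) y \<in> \<real>\<^sub>\<ge>\<^sub>0" by simp
    qed
  qed
qed

lemma matrix_eq_0_axis:
  assumes "\<And>i. d *v axis i 1 = 0"
  shows "d = (0 :: complex^'a^'b)"
  using assms matrix_vector_axis_component[of d] by (simp add: vec_eq_iff)

text \<open>Cholesky: subtracting one rank-one piece per basis vector kills all columns in turn.\<close>

lemma psd_sum_outer:
  fixes d :: "complex ^ 'a ^ 'a"
  assumes "psd d"
  obtains L :: "'a \<Rightarrow> complex ^ 'a" where "d = (\<Sum>i\<in>UNIV. outer (L i))"
proof -
  have "\<exists>L :: 'a \<Rightarrow> complex ^ 'a. psd (d - (\<Sum>i\<in>A. outer (L i))) \<and> (\<forall>i\<in>A. (d - (\<Sum>i\<in>A. outer (L i))) *v axis i 1 = 0)"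
    for A :: "'a set"
  proof (induction A rule: finite_induct[OF finite])
    case 1
    then show ?case using assms by simp
  next
    case (2 a A)
    then obtain L where L: "psd (d - (\<Sum>i\<in>A. outer (L i)))"
      "\<And>i. i \<in> A \<Longrightarrow> (d - (\<Sum>i\<in>A. outer (L i))) *v axis i 1 = 0" by blast
    obtain u where u: "psd (d - (\<Sum>i\<in>A. outer (L i)) - outer u)"
      "(d - (\<Sum>i\<in>A. outer (L i)) - outer u) *v axis a 1 = 0"
      "\<And>x. (d - (\<Sum>i\<in>A. outer (L i))) *v x = 0 \<Longrightarrow> (d - (\<Sum>i\<in>A. outer (L i)) - outer u) *v x = 0"
      using psd_subtract_column[OF L(1), of "axis a 1"] by blast
    have "(\<Sum>i\<in>insert a A. outer ((L(a := u)) i)) = (\<Sum>i\<in>A. outer (L i)) + outer u"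
      using 2 by (auto intro: sum.cong simp: add.commute)
    then have "d - (\<Sum>i\<in>insert a A. outer ((L(a := u)) i)) = d - (\<Sum>i\<in>A. outer (L i)) - outer u"
      by simp
    with u L(2) show ?case
      by (metis insert_iff)
  qed
  from this[of UNIV] obtain L :: "'a \<Rightarrow> complex ^ 'a" where "\<And>i. (d - (\<Sum>i\<in>UNIV. outer (L i))) *v axis i 1 = 0"
    by auto
  then have "d - (\<Sum>i\<in>UNIV. outer (L i)) = 0" by (rule matrix_eq_0_axis)
  then show ?thesis using that[of L] by simp
qed

section \<open>Functionals and their density matrices\<close>

definition trace_functional :: "complex ^ 'a ^ 'a \<Rightarrow> complex ^ 'a ^ 'a \<Rightarrow> complex" where
  "trace_functional d = (\<lambda>x. trace (d ** x))"

definition matrix_unit :: "'a \<Rightarrow> 'b \<Rightarrow> complex ^ 'b ^ 'a" where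
  "matrix_unit p q = (\<chi> i j. if i = p \<and> j = q then 1 else 0)"

text \<open>Agrees with \<open>density\<close> on linear functionals; the entrywise formula makes continuity immediate.\<close>

definition dens :: "(complex ^ 'a ^ 'a \<Rightarrow> complex) \<Rightarrow> complex ^ 'a ^ 'a" where
  "dens \<phi> = (\<chi> q p. \<phi> (matrix_unit p q))"

lemma trace_functional_sum: "trace_functional d x = (\<Sum>q\<in>UNIV. \<Sum>p\<in>UNIV. d $ q $ p * x $ p $ q)"
  by (simp add: trace_functional_def trace_def matrix_matrix_mult_def)

lemma trace_functional_matrix_unit: "trace_functional d (matrix_unit p q) = d $ q $ p"
proof -
  have "trace_functional d (matrix_unit p q) = (\<Sum>q'\<in>UNIV. \<Sum>p'\<in>UNIV. if q' = q then (if p' = p then d $ q $ p else 0) else 0)"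
    unfolding trace_functional_sum by (intro sum.cong refl) (simp add: matrix_unit_def)
  also have "\<dots> = (\<Sum>q'\<in>UNIV. if q' = q then (\<Sum>p'\<in>UNIV. (if p' = p then d $ q $ p else 0)) else 0)"
    by (intro sum.cong refl) simp
  finally show ?thesis by simp
qed

lemma dens_trace_functional [simp]: "dens (trace_functional d) = d"
  by (simp add: dens_def vec_eq_iff trace_functional_matrix_unit)

lemma trace_functional_inject: "trace_functional d = trace_functional e \<longleftrightarrow> d = e"
  by (metis dens_trace_functional)

lemma density_trace_functional [simp]: "density (trace_functional d) = d"
  unfolding density_def
proof (rule the_equality)
  show "\<forall>x. trace_functional d x = trace (d ** x)" by (simp add: trace_functional_def)
  show "e = d" if "\<forall>x. trace_functional d x = trace (e ** x)" for e
    using that by (metis trace_functional_def trace_functional_inject ext)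
qed

lemma linear_functional_trace_functional:
  fixes \<phi> :: "complex ^ 'a ^ 'a \<Rightarrow> complex"
  assumes add: "\<And>x y. \<phi> (x + y) = \<phi> x + \<phi> y"
    and scale: "\<And>c x. \<phi> (\<chi> i j. c * x $ i $ j) = c * \<phi> x"
  shows "\<phi> = trace_functional (dens \<phi>)"
proof
  fix x :: "complex ^ 'a ^ 'a"
  have zero: "\<phi> 0 = 0" using add[of 0 0] by simp
  have sum: "\<phi> (\<Sum>i\<in>A. f i) = (\<Sum>i\<in>A. \<phi> (f i))" for A :: "'i set" and f
    by (induction A rule: infinite_finite_induct) (auto simp: zero add)
  have "x = (\<Sum>q\<in>UNIV. \<Sum>p\<in>UNIV. (\<chi> i j. x $ p $ q * matrix_unit p q $ i $ j))"
  proof -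
    have "(\<Sum>q\<in>UNIV. \<Sum>p\<in>UNIV. x $ p $ q * matrix_unit p q $ i $ j) = x $ i $ j" for i j
    proof -
      have *: "x $ p $ j * (if i = p then 1 else 0) = (if i = p then x $ p $ j else 0)" for p
        by simp
      have "(\<Sum>q\<in>UNIV. \<Sum>p\<in>UNIV. x $ p $ q * matrix_unit p q $ i $ j) =
        (\<Sum>q\<in>UNIV. if j = q then \<Sum>p\<in>UNIV. if i = p then x $ p $ q else 0 else 0)"
        by (intro sum.cong refl) (auto simp: matrix_unit_def *)
      then show ?thesis by simp
    qed
    then show ?thesis by (simp add: vec_eq_iff)
  qed
  then have "\<phi> x = \<phi> (\<Sum>q\<in>UNIV. \<Sum>p\<in>UNIV. (\<chi> i j. x $ p $ q * matrix_unit p q $ i $ j))"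
    by (rule arg_cong)
  also have "\<dots> = (\<Sum>q\<in>UNIV. \<Sum>p\<in>UNIV. x $ p $ q * \<phi> (matrix_unit p q))"
    by (simp only: sum scale)
  finally show "\<phi> x = trace_functional (dens \<phi>) x"
    by (simp add: trace_functional_sum dens_def mult.commute)
qed

lemma trace_outer: "trace (outer u) = cip u u"
  by (simp add: trace_def outer_def cip_def)

lemma trace_functional_outer_arg: "trace_functional d (outer y) = cip (d *v y) y"
  by (simp add: trace_functional_sum outer_def cip_def matrix_vector_mult_def sum_distrib_left ac_simps)

lemma trace_functional_add: "trace_functional (d + e) x = trace_functional d x + trace_functional e x"
  by (simp add: trace_functional_sum sum.distrib algebra_simps)

lemma trace_functional_scaleR: "trace_functional (c *\<^sub>R d) x = of_real c * trace_functional d x"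
  by (simp add: trace_functional_sum sum_distrib_left scaleR_conv_of_real[where 'a = complex] mult.assoc)

lemma trace_functional_zero [simp]: "trace_functional 0 x = 0"
  by (simp add: trace_functional_sum)

lemma trace_functional_sum_left: "trace_functional (\<Sum>i\<in>A. f i) x = (\<Sum>i\<in>A. trace_functional (f i) x)"
  by (induction A rule: infinite_finite_induct) (auto simp: trace_functional_add)

lemma trace_functional_mat1: "trace_functional d (mat 1) = trace d"
  by (simp add: trace_functional_def)

lemma trace_functional_outer: "trace_functional (outer u) x = cip (x *v u) u"
  unfolding trace_functional_sum cip_def matrix_vector_mult_def outer_def
  by (subst sum.swap) (simp add: sum_distrib_left ac_simps)

lemma is_state_trace_functional:
  assumes "psd d" "trace d = 1"
  shows "is_state (trace_functional d)"
  unfolding is_state_def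
proof (intro conjI allI)
  fix x y :: "complex^'a^'a" and c :: complex
  show "trace_functional d (x + y) = trace_functional d x + trace_functional d y"
    by (simp add: trace_functional_sum sum.distrib algebra_simps)
  show "trace_functional d (\<chi> i j. c * x $ i $ j) = c * trace_functional d x"
    by (simp add: trace_functional_sum sum_distrib_left ac_simps)
  show "trace_functional d (mat 1) = 1" using assms by (simp add: trace_functional_mat1)
  \<comment> \<open>The conjugated rows of x split \<open>adj x ** x\<close> into rank-one pieces,
    on which the functional is the quadratic form of d.\<close>
  define w where "w i = (\<chi> p. cnj (x $ i $ p))" for i
  have "adj x ** x = (\<Sum>i\<in>UNIV. outer (w i))"
    by (simp add: vec_eq_iff matrix_matrix_mult_def adj_def outer_def w_def)
  moreover have "trace_functional d (\<Sum>i\<in>A. outer (w i)) = (\<Sum>i\<in>A. trace_functional d (outer (w i)))" for A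
    by (induction A rule: infinite_finite_induct) (auto simp: trace_functional_sum sum.distrib algebra_simps)
  moreover have "(\<Sum>i\<in>UNIV. trace_functional d (outer (w i))) \<in> \<real>\<^sub>\<ge>\<^sub>0"
    using assms by (simp add: trace_functional_outer_arg psd_def complex_nonneg_Reals_iff sum_nonneg)
  ultimately show "trace_functional d (adj x ** x) \<in> \<real>\<^sub>\<ge>\<^sub>0" by simp
qed

text \<open>Take x with one possibly nonzero row, the conjugate of y. Positivity and faithfulness
  are stated for products \<open>adj x ** x\<close>; this lets both be tested on vectors.\<close>

lemma outer_eq_adj: "\<exists>x :: complex^'a^'a. outer y = adj x ** x \<and> (y \<noteq> 0 \<longrightarrow> x \<noteq> 0)" for y :: "complex^'a"
proof -
  obtain i0 :: 'a where True by simp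
  let ?x = "\<chi> i j. if i = i0 then cnj (y $ j) else 0"
  have "(adj ?x ** ?x) $ j $ k = outer y $ j $ k" for j k
  proof -
    have "(adj ?x ** ?x) $ j $ k = (\<Sum>i\<in>UNIV. if i = i0 then y $ j * cnj (y $ k) else 0)"
      unfolding matrix_matrix_mult_def adj_def
      by (simp add: if_distrib cong: if_cong)
    then show ?thesis by (simp add: outer_def)
  qed
  moreover have "?x \<noteq> 0" if "y \<noteq> 0"
    using that by (auto simp: vec_eq_iff)
  ultimately show ?thesis by (metis vec_eq_iff)
qed

lemma is_stateD:
  assumes "is_state \<phi>"
  shows "\<phi> = trace_functional (dens \<phi>)" "psd (dens \<phi>)" "trace (dens \<phi>) = 1"
proof -
  show 1: "\<phi> = trace_functional (dens \<phi>)"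
    using assms by (intro linear_functional_trace_functional) (auto simp: is_state_def)
  show "psd (dens \<phi>)"
    unfolding psd_def
  proof
    fix y :: "complex ^ 'a"
    show "cip (dens \<phi> *v y) y \<in> \<real>\<^sub>\<ge>\<^sub>0"
      using assms outer_eq_adj[of y] 1 unfolding is_state_def by (metis trace_functional_outer_arg)
  qed
  show "trace (dens \<phi>) = 1"
    using assms 1 by (metis is_state_def trace_functional_mat1)
qed

lemma is_state_iff: "is_state (trace_functional d) \<longleftrightarrow> psd d \<and> trace d = 1"
  using is_state_trace_functional is_stateD(2,3)[of "trace_functional d"] by auto

lemma faithful_pos:
  fixes \<omega> :: "complex ^ 'a ^ 'a \<Rightarrow> complex"
  assumes "is_state \<omega>" "faithful \<omega>" "y \<noteq> 0"
  shows "cip (dens \<omega> *v y) y \<noteq> 0"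
proof -
  obtain x :: "complex ^ 'a ^ 'a" where x: "outer y = adj x ** x" "x \<noteq> 0"
    using outer_eq_adj[of y] assms(3) by blast
  then have "\<omega> (outer y) \<noteq> 0"
    using assms(2) unfolding faithful_def by metis
  moreover have "\<omega> (outer y) = cip (dens \<omega> *v y) y"
    using fun_cong[OF is_stateD(1)[OF assms(1)]] trace_functional_outer_arg by (rule trans)
  ultimately show ?thesis by simp
qed

section \<open>Separable states\<close>

definition tensor_vec :: "complex ^ 'k \<Rightarrow> complex ^ 'h \<Rightarrow> complex ^ ('k \<times> 'h)" where
  "tensor_vec a b = (\<chi> p. a $ fst p * b $ snd p)"

definition densities :: "(complex ^ 'a ^ 'a) set" where
  "densities = {d. psd d \<and> trace d = 1}"

text \<open>Intersecting with \<open>densities\<close> mirrors the clause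
  \<open>is_state \<rho>\<close> of \<open>product_states\<close>: positivity of the tensor product
  is part of membership.\<close>

definition product_densities :: "(complex ^ ('k::finite \<times> 'h::finite) ^ ('k \<times> 'h)) set" where
  "product_densities = densities \<inter> (\<lambda>(s, t). s \<otimes> t) ` (densities \<times> densities)"

lemma is_state_densities: "is_state (trace_functional d) \<longleftrightarrow> d \<in> densities"
  by (simp add: is_state_iff densities_def)

lemma dens_densities: "is_state \<phi> \<Longrightarrow> dens \<phi> \<in> densities"
  using is_stateD[of \<phi>] by (simp add: densities_def)

lemma sum_prod_UNIV: "(\<Sum>p\<in>UNIV. f p) = (\<Sum>a\<in>UNIV. \<Sum>b\<in>UNIV. f (a, b))"
  by (simp add: sum.cartesian_product)

lemma trace_functional_otimes: "trace_functional (s \<otimes> t) (a \<otimes> b) = trace_functional s a * trace_functional t b"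
proof -
  have "trace_functional (s \<otimes> t) (a \<otimes> b) = (\<Sum>i\<in>UNIV. \<Sum>j\<in>UNIV. \<Sum>k\<in>UNIV. \<Sum>l\<in>UNIV.
      (s $ i $ k * a $ k $ i) * (t $ j $ l * b $ l $ j))"
    by (simp add: trace_functional_sum sum_prod_UNIV otimes_def ac_simps)
  also have "\<dots> = (\<Sum>i\<in>UNIV. \<Sum>k\<in>UNIV. \<Sum>j\<in>UNIV. \<Sum>l\<in>UNIV.
      (s $ i $ k * a $ k $ i) * (t $ j $ l * b $ l $ j))"
    by (intro sum.cong refl sum.swap)
  also have "\<dots> = trace_functional s a * trace_functional t b"
    by (simp only: trace_functional_sum sum_distrib_right) (simp only: sum_distrib_left)
  finally show ?thesis .
qed

lemma matrix_unit_otimes: "matrix_unit p q = matrix_unit (fst p) (fst q) \<otimes> matrix_unit (snd p) (snd q)"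
  by (auto simp: matrix_unit_def otimes_def vec_eq_iff prod_eq_iff)

text \<open>Matrix units of the tensor product are elementary tensors of matrix units, so the
  product rule on elementary tensors factors the density entry by entry.\<close>

lemma product_states_trace_functional:
  "(product_states :: (complex ^ ('a::finite \<times> 'b::finite) ^ ('a \<times> 'b) \<Rightarrow> complex) set) = trace_functional ` product_densities"
proof (intro set_eqI iffI)
  fix \<rho> :: "complex ^ ('a \<times> 'b) ^ ('a \<times> 'b) \<Rightarrow> complex"
  assume "\<rho> \<in> product_states"
  then obtain \<sigma> \<tau> where st: "is_state \<rho>" "is_state \<sigma>" "is_state \<tau>"
    and eq: "\<And>(a :: complex^'a^'a) (b :: complex^'b^'b). \<rho> (a \<otimes> b) = \<sigma> a * \<tau> b"
    by (auto simp: product_states_def)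
  have "dens \<rho> = dens \<sigma> \<otimes> dens \<tau>"
    by (simp add: vec_eq_iff dens_def otimes_def[of "\<chi> i j. _ i j"])
      (simp add: matrix_unit_otimes eq)
  then have "dens \<rho> \<in> product_densities"
    using st[THEN dens_densities] unfolding product_densities_def by auto
  then show "\<rho> \<in> trace_functional ` product_densities"
    using is_stateD(1)[OF st(1)] by blast
next
  fix \<rho> :: "complex ^ ('a \<times> 'b) ^ ('a \<times> 'b) \<Rightarrow> complex"
  assume "\<rho> \<in> trace_functional ` product_densities"
  then obtain s t where "\<rho> = trace_functional (s \<otimes> t)" "s \<otimes> t \<in> densities" "s \<in> densities" "t \<in> densities"
    by (auto simp: product_densities_def)
  then show "\<rho> \<in> product_states"
    by (auto simp: product_states_def is_state_densities trace_functional_otimes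
        intro!: exI[of _ "trace_functional s"] exI[of _ "trace_functional t"])
qed

section \<open>Compactness of the densities and separability as hull membership\<close>

lemma convex_densities: "convex densities"
proof (rule convexI)
  fix x y :: "complex ^ 'a ^ 'a" and u v :: real
  assume xy: "x \<in> densities" "y \<in> densities" and uv: "0 \<le> u" "0 \<le> v" "u + v = 1"
  have "trace (u *\<^sub>R x + v *\<^sub>R y) = of_real u * trace x + of_real v * trace y"
    by (simp add: trace_def sum.distrib sum_distrib_left scaleR_conv_of_real[where 'a = complex])
  with xy uv show "u *\<^sub>R x + v *\<^sub>R y \<in> densities"
    by (auto simp: densities_def intro!: psd_add psd_scaleR simp flip: of_real_add)
qed

lemma continuous_on_cip:
  assumes "continuous_on S f" "continuous_on S g"
  shows "continuous_on S (\<lambda>x. cip (f x) (g x))"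
  unfolding cip_def by (intro continuous_intros assms)

lemma continuous_on_matrix_vector_mult:
  fixes f :: "_ \<Rightarrow> complex ^ 'a ^ 'b"
  assumes "continuous_on S f" "continuous_on S g"
  shows "continuous_on S (\<lambda>x. f x *v g x)"
  unfolding matrix_vector_mult_def by (intro continuous_intros assms)

lemma norm_le_sum_entries: "norm d \<le> (\<Sum>p\<in>UNIV. \<Sum>q\<in>UNIV. cmod (d $ p $ q))"
proof -
  have "norm x \<le> (\<Sum>i\<in>UNIV. norm (x $ i))" for x :: "'c::real_normed_vector ^ 'd"
    unfolding norm_vec_def by (rule L2_set_le_sum) auto
  then have "norm d \<le> (\<Sum>p\<in>UNIV. norm (d $ p))"
    "(\<Sum>p\<in>UNIV. norm (d $ p)) \<le> (\<Sum>p\<in>UNIV. \<Sum>q\<in>UNIV. cmod (d $ p $ q))"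
    by (blast intro: sum_mono)+
  then show ?thesis by (rule order_trans)
qed

text \<open>In a decomposition into rank-one pieces the squared norms of the vectors add up to the
  trace, which is 1, and each entry is bounded by this sum. Boundedness of the set of densities
  rests on this.\<close>

lemma density_entry_le:
  fixes d :: "complex ^ 'a ^ 'a"
  assumes "d \<in> densities"
  shows "cmod (d $ p $ q) \<le> 1"
proof -
  have "psd d" using assms by (simp add: densities_def)
  then obtain L :: "'a \<Rightarrow> complex ^ 'a" where L: "d = (\<Sum>i\<in>UNIV. outer (L i))"
    by (rule psd_sum_outer)
  have "(\<Sum>i\<in>UNIV. (norm (L i))\<^sup>2) = 1"
  proof -
    have "trace d = (\<Sum>i\<in>UNIV. trace (outer (L i)))"
      unfolding L trace_def by (simp, rule sum.swap)
    also have "\<dots> = of_real (\<Sum>i\<in>UNIV. (norm (L i))\<^sup>2)"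
      by (simp add: trace_outer cip_self)
    finally have "complex_of_real (\<Sum>i\<in>UNIV. (norm (L i))\<^sup>2) = 1"
      using assms by (simp add: densities_def)
    then show ?thesis by (simp only: of_real_eq_1_iff)
  qed
  moreover have "cmod (d $ p $ q) \<le> (\<Sum>i\<in>UNIV. (norm (L i))\<^sup>2)"
  proof -
    have "cmod (d $ p $ q) \<le> (\<Sum>i\<in>UNIV. cmod (L i $ p * cnj (L i $ q)))"
      unfolding L by (simp add: outer_def norm_sum)
    also have "\<dots> \<le> (\<Sum>i\<in>UNIV. (norm (L i))\<^sup>2)"
      by (intro sum_mono) (auto simp: norm_mult power2_eq_square intro!: mult_mono Finite_Cartesian_Product.norm_nth_le)
    finally show ?thesis .
  qed
  ultimately show ?thesis by simp
qed

lemma compact_densities: "compact (densities :: (complex ^ 'a ^ 'a) set)"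
proof -
  have "closed (densities :: (complex ^ 'a ^ 'a) set)"
  proof -
    have eq: "densities = (\<Inter>y. (\<lambda>d :: complex ^ 'a ^ 'a. cip (d *v y) y) -` \<real>\<^sub>\<ge>\<^sub>0) \<inter> trace -` {1}"
      by (auto simp: densities_def psd_def)
    show ?thesis
      unfolding eq
    proof (intro closed_Int closed_INT ballI continuous_closed_vimage closed_singleton
        closed_nonneg_Reals_complex)
      have "continuous_on UNIV (\<lambda>d :: complex ^ 'a ^ 'a. cip (d *v y) y)" for y
        by (intro continuous_on_cip continuous_on_matrix_vector_mult continuous_on_id continuous_on_const)
      then show "isCont (\<lambda>d :: complex ^ 'a ^ 'a. cip (d *v y) y) x" for x y
        by (simp add: continuous_on_eq_continuous_at)
      have "continuous_on UNIV (trace :: complex ^ 'a ^ 'a \<Rightarrow> complex)"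
        unfolding trace_def by (intro continuous_intros)
      then show "isCont (trace :: complex ^ 'a ^ 'a \<Rightarrow> complex) x" for x
        by (simp add: continuous_on_eq_continuous_at)
    qed
  qed
  moreover have "bounded (densities :: (complex ^ 'a ^ 'a) set)"
    unfolding bounded_iff
  proof (intro exI ballI)
    fix d :: "complex ^ 'a ^ 'a"
    assume d: "d \<in> densities"
    have "norm d \<le> (\<Sum>p\<in>UNIV. \<Sum>q\<in>UNIV. cmod (d $ p $ q))"
      by (rule norm_le_sum_entries)
    also have "\<dots> \<le> (\<Sum>p\<in>(UNIV :: 'a set). \<Sum>q\<in>(UNIV :: 'a set). 1)"
      by (intro sum_mono density_entry_le d)
    finally show "norm d \<le> (\<Sum>p\<in>(UNIV :: 'a set). \<Sum>q\<in>(UNIV :: 'a set). 1)" .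
  qed
  ultimately show ?thesis by (simp add: compact_eq_bounded_closed)
qed

lemma compact_product_densities: "compact (product_densities :: (complex ^ ('a::finite \<times> 'b::finite) ^ ('a \<times> 'b)) set)"
proof -
  have "continuous_on (densities \<times> densities) (\<lambda>st. fst st \<otimes> (snd st :: complex^'b^'b) :: complex ^ ('a \<times> 'b) ^ ('a \<times> 'b))"
    unfolding otimes_def by (intro continuous_intros)
  then have "compact ((\<lambda>st. fst st \<otimes> (snd st :: complex^'b^'b) :: complex ^ ('a \<times> 'b) ^ ('a \<times> 'b)) ` (densities \<times> densities))"
    by (intro compact_continuous_image compact_Times compact_densities)
  then show ?thesis
    unfolding product_densities_def case_prod_beta by (intro compact_Int compact_densities)
qed

lemma hull_product_densities_subset: "convex hull product_densities \<subseteq> densities"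
  by (rule hull_minimal) (auto simp: product_densities_def convex_densities)

lemma separable_state_iff:
  "separable_state \<rho> \<longleftrightarrow> is_state \<rho> \<and> dens \<rho> \<in> convex hull product_densities"
proof (cases "is_state \<rho>")
  case st: True
  show ?thesis
  proof
    assume "separable_state \<rho>"
    then obtain N :: nat and t \<pi> where t: "\<And>i. i < N \<Longrightarrow> 0 \<le> t i \<and> \<pi> i \<in> product_states"
      "(\<Sum>i<N. t i) = 1" and eq: "\<And>x. \<rho> x = (\<Sum>i<N. complex_of_real (t i) * \<pi> i x)"
      unfolding separable_state_def by blast
    have "dens (\<pi> i) \<in> product_densities" if "i < N" for i
      using t(1)[OF that] by (auto simp: product_states_trace_functional)
    then have "(\<Sum>i<N. t i *\<^sub>R dens (\<pi> i)) \<in> convex hull product_densities"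
      using t by (intro convex_sum) (auto intro: hull_inc)
    moreover have "dens \<rho> = (\<Sum>i<N. t i *\<^sub>R dens (\<pi> i))"
      by (simp add: vec_eq_iff dens_def eq scaleR_conv_of_real[where 'a = complex])
    ultimately show "is_state \<rho> \<and> dens \<rho> \<in> convex hull product_densities" using st by simp
  next
    assume "is_state \<rho> \<and> dens \<rho> \<in> convex hull product_densities"
    then have "dens \<rho> \<in> convex hull product_densities" ..
    then obtain k :: nat and u x where u: "\<forall>i\<in>{1..k}. 0 \<le> u i \<and> x i \<in> product_densities"
      "sum u {1..k} = 1" "(\<Sum>i = 1..k. u i *\<^sub>R x i) = dens \<rho>"
      unfolding convex_hull_indexed mem_Collect_eq by (elim exE conjE)
    \<comment> \<open>\<open>convex_hull_indexed\<close> counts from 1 and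
      \<open>separable_state\<close> from 0, hence the shift by \<open>Suc\<close>.\<close>
    have "\<rho> y = (\<Sum>i<k. complex_of_real (u (Suc i)) * trace_functional (x (Suc i)) y)" for y
    proof -
      have "\<rho> y = trace_functional (\<Sum>i = 1..k. u i *\<^sub>R x i) y"
        unfolding u(3) using is_stateD(1)[OF st] by (rule fun_cong)
      then show ?thesis
        by (simp add: trace_functional_sum_left trace_functional_scaleR sum.atLeast1_atMost_eq)
    qed
    moreover have "(\<Sum>i<k. u (Suc i)) = 1"
      using u(2) by (simp add: sum.atLeast1_atMost_eq)
    moreover have "\<forall>i<k. 0 \<le> u (Suc i) \<and> trace_functional (x (Suc i)) \<in> product_states"
      using u(1) by (auto simp: product_states_trace_functional)
    ultimately show "separable_state \<rho>"
      unfolding separable_state_def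
      using st by (intro conjI exI[of _ k] exI[of _ "\<lambda>i. u (Suc i)"] exI[of _ "\<lambda>i. trace_functional (x (Suc i))"]) auto
  qed
qed (simp add: separable_state_def)

section \<open>The cone generated by product densities\<close>

definition sepcone :: "(complex ^ ('k::finite \<times> 'h::finite) ^ ('k \<times> 'h)) set" where
  "sepcone = convex_cone hull product_densities"

lemma sepcone_add: "x \<in> sepcone \<Longrightarrow> y \<in> sepcone \<Longrightarrow> x + y \<in> sepcone"
  unfolding sepcone_def by (rule convex_cone_hull_add)

lemma sepcone_scaleR: "x \<in> sepcone \<Longrightarrow> 0 \<le> c \<Longrightarrow> c *\<^sub>R x \<in> sepcone"
  unfolding sepcone_def by (rule convex_cone_hull_mul)

lemma sepcone_0: "0 \<in> sepcone"
  unfolding sepcone_def by (rule convex_cone_hull_contains_0)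

lemma sepcone_sum: "(\<And>i. i \<in> A \<Longrightarrow> f i \<in> sepcone) \<Longrightarrow> (\<Sum>i\<in>A. f i) \<in> sepcone"
  by (induction A rule: infinite_finite_induct) (auto intro: sepcone_add sepcone_0)

lemma sepcone_psd: "x \<in> sepcone \<Longrightarrow> psd x"
proof -
  have "sepcone \<subseteq> {x :: complex ^ ('a \<times> 'b) ^ ('a \<times> 'b). psd x}"
    unfolding sepcone_def
    by (rule hull_minimal)
      (auto simp: product_densities_def densities_def convex_cone_iff intro: psd_add psd_scaleR)
  then show "psd x" if "x \<in> sepcone" for x :: "complex ^ ('a \<times> 'b) ^ ('a \<times> 'b)"
    using that by blast
qed

lemma trace_scaleR: "trace (c *\<^sub>R d) = of_real c * trace d" for d :: "complex ^ 'a ^ 'a"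
  by (simp add: trace_def sum_distrib_left scaleR_conv_of_real[where 'a = complex])

text \<open>The way back from the cone to states: a nonzero element is a multiple of a hull element,
  hull elements have trace 1, and so the trace reads off the multiplier. Sums and differences can
  thus be treated in the cone without normalization.\<close>

lemma sepcone_trace_1:
  assumes "x \<in> sepcone" "trace x = 1"
  shows "x \<in> convex hull product_densities"
proof -
  have "x \<noteq> 0" using assms(2) by (auto simp: trace_def)
  then obtain c y where y: "y \<in> convex hull product_densities" "x = c *\<^sub>R y"
    using assms(1) unfolding sepcone_def convex_cone_hull_convex_hull by auto
  then have "trace y = 1" using hull_product_densities_subset by (auto simp: densities_def)
  then have "c = 1" using assms(2) y(2) by (simp add: trace_scaleR)
  with y show ?thesis by simp
qed

lemma separable_state_trace_functional:
  assumes "d \<in> sepcone" "trace d = 1"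
  shows "separable_state (trace_functional d)"
  using sepcone_trace_1[OF assms] hull_product_densities_subset
  by (auto simp: separable_state_iff is_state_densities)

lemma outer_scale: "outer (of_real c *s u) = (c\<^sup>2) *\<^sub>R outer u"
  by (simp add: vec_eq_iff outer_def scaleR_conv_of_real[where 'a = complex] power2_eq_square)

text \<open>After normalizing both factors the vector gives a product density; the cone absorbs the
  squared norms. A zero factor cannot be normalized and gives the apex 0.\<close>

lemma outer_tensor_vec_sepcone: "outer (tensor_vec a b) \<in> sepcone"
proof (cases "a = 0 \<or> b = 0")
  case True
  then have "outer (tensor_vec a b) = 0" by (auto simp: outer_def tensor_vec_def vec_eq_iff)
  then show ?thesis by (simp add: sepcone_0)
next
  case False
  define a' b' where "a' = of_real (1 / norm a) *s a" and "b' = of_real (1 / norm b) *s b"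
  have "cip (of_real (1 / norm c) *s c) (of_real (1 / norm c) *s c) = 1" if "c \<noteq> 0"
    for c :: "complex ^ 'c"
    unfolding cip_scale_left cip_scale_right cip_self[of c] using that by (simp add: power2_eq_square)
  then have "cip a' a' = 1" "cip b' b' = 1"
    using False by (simp_all only: a'_def b'_def) auto
  then have dens: "outer a' \<in> densities" "outer b' \<in> densities"
    by (simp_all add: densities_def trace_outer)
  have "cip (tensor_vec a' b') (tensor_vec a' b') = cip a' a' * cip b' b'"
    by (simp add: cip_def tensor_vec_def sum_prod_UNIV sum_product ac_simps)
  then have "outer (tensor_vec a' b') \<in> densities"
    using \<open>cip a' a' = 1\<close> \<open>cip b' b' = 1\<close> by (simp add: densities_def trace_outer)
  moreover have "outer (tensor_vec a' b') = outer a' \<otimes> outer b'"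
    by (simp add: vec_eq_iff outer_def tensor_vec_def otimes_def)
  ultimately have "outer (tensor_vec a' b') \<in> product_densities"
    using dens unfolding product_densities_def by auto
  then have "(norm a * norm b)\<^sup>2 *\<^sub>R outer (tensor_vec a' b') \<in> sepcone"
    unfolding sepcone_def by (intro convex_cone_hull_mul hull_inc) auto
  moreover have "tensor_vec a b = of_real (norm a * norm b) *s tensor_vec a' b'"
    using False by (simp add: vec_eq_iff tensor_vec_def a'_def b'_def)
  ultimately show ?thesis by (simp only: outer_scale)
qed

section \<open>The interior of the separable cone and pure states\<close>

text \<open>Averaging the product vectors over the fourth roots of unity \<open>z\<close> leaves, off the diagonal,
  only a prescribed matrix unit and its adjoint.\<close>

lemma fourth_roots_average:
  fixes A A' B B' C C' G G' w :: complex
  assumes "w * cnj w = 1"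
  shows "(\<Sum>z\<in>{1, -1, \<i>, -\<i>}. ((A + z * B) * (C + cnj z * cnj w * G)) * ((A' + cnj z * B') * (C' + z * w * G')))
    = 4 * ((A * A' + B * B') * (C * C' + G * G') + w * A * B' * C * G' + cnj w * B * A' * G * C')"
proof -
  have ii: "\<i> * (\<i> * x) = - x" for x by (simp flip: mult.assoc)
  have ww: "w * (cnj w * x) = x" "cnj w * (w * x) = x" for x
    using assms by (simp_all flip: mult.assoc add: mult.commute[of "cnj w"])
  have d: "1 \<noteq> - \<i>" "\<i> \<noteq> - \<i>" "-1 \<noteq> \<i>" "1 \<noteq> \<i>" "1 \<noteq> (-1 :: complex)"
    by (simp_all add: complex_eq_iff)
  show ?thesis
    using d by (simp add: algebra_simps ii ww)
qed

lemma tensor_vec_axis: "tensor_vec (axis a 1) (axis b 1) = axis (a, b) 1"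
  by (auto simp: vec_eq_iff tensor_vec_def axis_def)

lemma diagonal_sepcone:
  fixes c :: "'k::finite \<times> 'h::finite \<Rightarrow> real"
  assumes "\<And>x. c x \<ge> 0"
  shows "(\<chi> x y. if x = y then of_real (c x) else 0) \<in> sepcone"
proof -
  have "(\<chi> x y. if x = y then of_real (c x) else 0) =
      (\<Sum>x\<in>UNIV. c x *\<^sub>R outer (tensor_vec (axis (fst x) 1) (axis (snd x) 1)))"
  proof -
    have "(\<Sum>z\<in>UNIV. c z *\<^sub>R outer (tensor_vec (axis (fst z) 1) (axis (snd z) 1)) $ x $ y) =
      (\<Sum>z\<in>UNIV. if z = x then (if x = y then of_real (c x) else 0) else 0)" for x y
      by (intro sum.cong refl)
        (simp add: tensor_vec_axis, simp add: outer_def axis_def scaleR_conv_of_real[where 'a = complex])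
    then show ?thesis by (simp add: vec_eq_iff)
  qed
  then show ?thesis using assms by (auto intro!: sepcone_sum sepcone_scaleR outer_tensor_vec_sepcone)
qed

lemma mat1_sepcone: "mat 1 \<in> sepcone"
  using diagonal_sepcone[of "\<lambda>_. 1"] by (simp add: mat_def cong: if_cong)

text \<open>With p = (i, k) and q = (j, l), average the product vectors (e_i + z e_j) \<otimes> (e_k
  + cnj z cnj w e_l) over the fourth roots of unity z. What appears besides the two wanted terms is
  diagonal, with entries 0, 1, 2 or 4; the value 4 occurs for p = q, which explains the constant.
  The free phase w serves to reach entries of any argument.\<close>

lemma matrix_unit_sepcone:
  fixes p q :: "'k::finite \<times> 'h::finite"
  assumes "cmod w = 1"
  shows "(\<chi> x y. w * matrix_unit p q $ x $ y + cnj w * matrix_unit q p $ x $ y) + 4 *\<^sub>R mat 1 \<in> sepcone"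
proof -
  obtain i k where p: "p = (i, k)" by (cases p)
  obtain j l where q: "q = (j, l)" by (cases q)
  have w: "w * cnj w = 1" using assms by (metis complex_norm_square of_real_1 one_power2)
  define \<delta> :: "'k \<Rightarrow> 'k \<Rightarrow> real" where "\<delta> a b = (if a = b then 1 else 0)" for a b
  define \<epsilon> :: "'h \<Rightarrow> 'h \<Rightarrow> real" where "\<epsilon> a b = (if a = b then 1 else 0)" for a b
  define u where "u z = tensor_vec (axis i 1 + z *s axis j 1) (axis k 1 + (cnj z * cnj w) *s axis l 1)" for z
  \<comment> \<open>What is left of the diagonal of \<open>4 *\<^sub>R mat 1\<close> after the
    diagonal part of the average; both factors are at most 2, so it is nonnegative.\<close>
  define c where "c x = 4 - (\<delta> i (fst x) + \<delta> j (fst x)) * (\<epsilon> k (snd x) + \<epsilon> l (snd x))" for x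
  have "(\<chi> x y. w * matrix_unit p q $ x $ y + cnj w * matrix_unit q p $ x $ y) + 4 *\<^sub>R mat 1 =
    (1/4) *\<^sub>R (\<Sum>z\<in>{1, -1, \<i>, -\<i>}. outer (u z)) + (\<chi> x y. if x = y then of_real (c x) else 0)"
    (is "?L = ?R")
  proof -
    have "?L $ x $ y = ?R $ x $ y" for x y
    proof -
      obtain a b where x: "x = (a, b)" by (cases x)
      obtain a' b' where y: "y = (a', b')" by (cases y)
      have uc: "u z $ (a, b) = (of_real (\<delta> i a) + z * of_real (\<delta> j a)) * (of_real (\<epsilon> k b) + cnj z * cnj w * of_real (\<epsilon> l b))"
        for z a b by (auto simp: u_def tensor_vec_def axis_def \<delta>_def \<epsilon>_def)
      have "(\<Sum>z\<in>{1, -1, \<i>, -\<i>}. outer (u z)) $ x $ y =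
        (\<Sum>z\<in>{1, -1, \<i>, -\<i>}. ((of_real (\<delta> i a) + z * of_real (\<delta> j a)) * (of_real (\<epsilon> k b) + cnj z * cnj w * of_real (\<epsilon> l b)))
         * ((of_real (\<delta> i a') + cnj z * of_real (\<delta> j a')) * (of_real (\<epsilon> k b') + z * w * of_real (\<epsilon> l b'))))"
        unfolding sum_component by (intro sum.cong refl) (simp add: outer_def x y uc)
      also have "\<dots> = 4 * ((of_real (\<delta> i a) * of_real (\<delta> i a') + of_real (\<delta> j a) * of_real (\<delta> j a')) *
          (of_real (\<epsilon> k b) * of_real (\<epsilon> k b') + of_real (\<epsilon> l b) * of_real (\<epsilon> l b'))
          + w * of_real (\<delta> i a) * of_real (\<delta> j a') * of_real (\<epsilon> k b) * of_real (\<epsilon> l b')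
          + cnj w * of_real (\<delta> j a) * of_real (\<delta> i a') * of_real (\<epsilon> l b) * of_real (\<epsilon> k b'))"
        by (rule fourth_roots_average[OF w])
      finally have s: "(1/4) *\<^sub>R (\<Sum>z\<in>{1, -1, \<i>, -\<i>}. outer (u z)) $ x $ y = \<dots> / 4"
        by (simp only: scaleR_conv_of_real) simp
      have m: "matrix_unit p q $ x $ y = of_real (\<delta> i a * \<delta> j a' * \<epsilon> k b * \<epsilon> l b')"
        "matrix_unit q p $ x $ y = of_real (\<delta> j a * \<delta> i a' * \<epsilon> l b * \<epsilon> k b')"
        by (auto simp: matrix_unit_def p q x y \<delta>_def \<epsilon>_def)
      have e: "(if x = y then of_real (c x) else 0) = (4 * (mat 1 $ x $ y) -
         (of_real (\<delta> i a) * of_real (\<delta> i a') + of_real (\<delta> j a) * of_real (\<delta> j a')) *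
          (of_real (\<epsilon> k b) * of_real (\<epsilon> k b') + of_real (\<epsilon> l b) * of_real (\<epsilon> l b')) :: complex)"
        by (auto simp: c_def x y mat_def \<delta>_def \<epsilon>_def)
      have "?R $ x $ y = (1/4) *\<^sub>R (\<Sum>z\<in>{1, -1, \<i>, -\<i>}. outer (u z)) $ x $ y + (if x = y then of_real (c x) else 0)"
        by simp
      also have "\<dots> = w * matrix_unit p q $ x $ y + cnj w * matrix_unit q p $ x $ y + 4 * mat 1 $ x $ y"
        unfolding s e m by (simp add: algebra_simps)
      also have "\<dots> = ?L $ x $ y"
        by (simp add: scaleR_conv_of_real[where 'a = complex])
      finally show ?thesis by simp
    qed
    then show ?thesis by (simp add: vec_eq_iff)
  qed
  moreover have "outer (u z) \<in> sepcone" for z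
    unfolding u_def by (rule outer_tensor_vec_sepcone)
  moreover have "c x \<ge> 0" for x
    by (simp add: c_def \<delta>_def \<epsilon>_def)
  ultimately show ?thesis
    by (simp only:) (intro sepcone_add sepcone_scaleR sepcone_sum diagonal_sepcone; simp)
qed

text \<open>Add the elements of \<open>matrix_unit_sepcone\<close> with weights
  \<open>cmod (X $ p $ q)\<close> and with the phases of the entries. Each entry is met twice, from
  (p, q) and from (q, p), so the sum is 2 X plus 4 s times the identity, where s is the sum of the
  moduli. Halving gives the constant 2.\<close>

lemma hermitian_sepcone:
  fixes X :: "complex ^ ('k::finite \<times> 'h::finite) ^ ('k \<times> 'h)"
  assumes herm: "\<And>p q. cnj (X $ p $ q) = X $ q $ p"
  shows "X + (2 * (\<Sum>p\<in>UNIV. \<Sum>q\<in>UNIV. cmod (X $ p $ q))) *\<^sub>R mat 1 \<in> sepcone"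
proof -
  \<comment> \<open>A vanishing entry has \<open>sgn\<close> equal to 0, which is not a phase; its
    weight is 0, so 1 will do.\<close>
  define w where "w p q = (if X $ p $ q = 0 then 1 else sgn (X $ p $ q))" for p q
  have w: "cmod (w p q) = 1" "of_real (cmod (X $ p $ q)) * w p q = X $ p $ q" for p q
    by (auto simp: w_def sgn_eq norm_divide)
  have w': "of_real (cmod (X $ p $ q)) * cnj (w p q) = X $ q $ p" for p q
    by (metis w(2) herm complex_cnj_mult complex_cnj_complex_of_real)
  define M where "M p q = (\<chi> x y. w p q * matrix_unit p q $ x $ y + cnj (w p q) * matrix_unit q p $ x $ y)" for p q
  define s where "s = (\<Sum>p\<in>UNIV. \<Sum>q\<in>UNIV. cmod (X $ p $ q))"
  have "(\<Sum>p\<in>UNIV. \<Sum>q\<in>UNIV. cmod (X $ p $ q) *\<^sub>R (M p q + 4 *\<^sub>R mat 1)) \<in> sepcone" (is "?S \<in> _")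
    unfolding M_def by (intro sepcone_sum sepcone_scaleR matrix_unit_sepcone w) simp
  moreover have "?S = 2 *\<^sub>R X + (4 * s) *\<^sub>R mat 1"
  proof -
    have "(\<Sum>p\<in>UNIV. \<Sum>q\<in>UNIV. cmod (X $ p $ q) *\<^sub>R M p q) $ x $ y = 2 * X $ x $ y" for x y
    proof -
      have "(\<Sum>p\<in>UNIV. \<Sum>q\<in>UNIV. cmod (X $ p $ q) *\<^sub>R M p q) $ x $ y =
        (\<Sum>p\<in>UNIV. \<Sum>q\<in>UNIV. X $ p $ q * matrix_unit p q $ x $ y) + (\<Sum>p\<in>UNIV. \<Sum>q\<in>UNIV. X $ q $ p * matrix_unit q p $ x $ y)"
        by (simp add: M_def scaleR_conv_of_real[where 'a = complex] distrib_left sum.distrib w w' flip: mult.assoc)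
      also have "(\<Sum>p\<in>UNIV. \<Sum>q\<in>UNIV. X $ q $ p * matrix_unit q p $ x $ y) = (\<Sum>p\<in>UNIV. \<Sum>q\<in>UNIV. X $ p $ q * matrix_unit p q $ x $ y)"
        by (rule sum.swap)
      also have "(\<Sum>p\<in>UNIV. \<Sum>q\<in>UNIV. X $ p $ q * matrix_unit p q $ x $ y) = trace_functional X (matrix_unit y x)"
        unfolding trace_functional_sum by (intro sum.cong refl) (auto simp: matrix_unit_def)
      finally show ?thesis by (simp add: trace_functional_matrix_unit)
    qed
    then have "(\<Sum>p\<in>UNIV. \<Sum>q\<in>UNIV. cmod (X $ p $ q) *\<^sub>R M p q) = 2 *\<^sub>R X"
      by (simp add: vec_eq_iff scaleR_conv_of_real[where 'a = complex])
    moreover have "(\<Sum>p\<in>UNIV. \<Sum>q\<in>UNIV. cmod (X $ p $ q) *\<^sub>R (4 *\<^sub>R mat 1 :: complex ^ ('k \<times> 'h) ^ ('k \<times> 'h))) = (4 * s) *\<^sub>R mat 1"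
      by (simp add: s_def scaleR_sum_left sum_distrib_left mult.commute)
    ultimately show ?thesis by (simp only: scaleR_add_right sum.distrib)
  qed
  ultimately have "(1/2) *\<^sub>R (2 *\<^sub>R X + (4 * s) *\<^sub>R mat 1) \<in> sepcone"
    by (metis sepcone_scaleR zero_le_divide_1_iff zero_le_numeral)
  then show ?thesis by (simp add: scaleR_add_right s_def)
qed

text \<open>Half of the margin pays for the Hermitian difference d - d0 through
  \<open>hermitian_sepcone\<close>; the other half remains as the margin of d.\<close>

lemma sepcone_perturb:
  fixes d :: "complex ^ ('k::finite \<times> 'h::finite) ^ ('k \<times> 'h)"
  assumes "d0 - \<epsilon> *\<^sub>R mat 1 \<in> sepcone" "psd d0" "psd d"
    and small: "2 * (\<Sum>p\<in>UNIV. \<Sum>q\<in>UNIV. cmod (d $ p $ q - d0 $ p $ q)) \<le> \<epsilon> / 2"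
  shows "d - (\<epsilon> / 2) *\<^sub>R mat 1 \<in> sepcone"
proof -
  define s where "s = 2 * (\<Sum>p\<in>UNIV. \<Sum>q\<in>UNIV. cmod ((d - d0) $ p $ q))"
  have "(d - d0) + s *\<^sub>R mat 1 \<in> sepcone"
    unfolding s_def using assms(2,3) by (intro hermitian_sepcone) (simp add: psd_hermitian)
  moreover have "(\<epsilon> / 2 - s) *\<^sub>R mat 1 \<in> sepcone"
    using small by (intro sepcone_scaleR mat1_sepcone) (simp add: s_def)
  ultimately have "(d0 - \<epsilon> *\<^sub>R mat 1) + (((d - d0) + s *\<^sub>R mat 1) + (\<epsilon> / 2 - s) *\<^sub>R mat 1) \<in> sepcone"
    using assms(1) by (blast intro: sepcone_add)
  moreover have "(d0 - \<epsilon> *\<^sub>R mat 1) + (((d - d0) + s *\<^sub>R mat 1) + (\<epsilon> / 2 - s) *\<^sub>R mat 1) = d - (\<epsilon> / 2) *\<^sub>R mat 1"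
  proof -
    have "\<epsilon> *\<^sub>R mat 1 = (\<epsilon> / 2) *\<^sub>R mat 1 + (\<epsilon> / 2) *\<^sub>R (mat 1 :: complex ^ ('k \<times> 'h) ^ ('k \<times> 'h))"
      by (simp flip: scaleR_add_left)
    then show ?thesis by (simp add: scaleR_diff_left)
  qed
  ultimately show ?thesis by simp
qed

section \<open>Neighbourhoods of states with a margin\<close>

lemma continuous_on_dens: "continuous_on UNIV dens"
  unfolding dens_def by (intro continuous_intros continuous_on_product_coordinates)

lemma sepcone_nhd:
  fixes d0 :: "complex ^ ('k::finite \<times> 'h::finite) ^ ('k \<times> 'h)"
  assumes "d0 - \<epsilon> *\<^sub>R mat 1 \<in> sepcone" "\<epsilon> > 0" "psd d0"
  obtains W where "open W" "trace_functional d0 \<in> W"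
    "\<And>\<phi>. \<phi> \<in> W \<Longrightarrow> is_state \<phi> \<Longrightarrow> dens \<phi> - (\<epsilon> / 2) *\<^sub>R mat 1 \<in> sepcone"
proof
  let ?W = "{\<phi>. 2 * (\<Sum>p\<in>UNIV. \<Sum>q\<in>UNIV. cmod (dens \<phi> $ p $ q - d0 $ p $ q)) < \<epsilon> / 2}"
  show "open ?W"
    by (intro open_Collect_less continuous_intros continuous_on_dens)
  show "trace_functional d0 \<in> ?W" using assms by simp
  show "dens \<phi> - (\<epsilon> / 2) *\<^sub>R mat 1 \<in> sepcone" if "\<phi> \<in> ?W" "is_state \<phi>" for \<phi>
    using that assms is_stateD(2)[of \<phi>] by (intro sepcone_perturb[of d0]) auto
qed

lemma sepcone_shift:
  assumes "d - c *\<^sub>R mat 1 \<in> sepcone" "c \<ge> 0"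
  shows "d \<in> sepcone"
proof -
  have "(d - c *\<^sub>R mat 1) + c *\<^sub>R mat 1 \<in> sepcone"
    using assms by (intro sepcone_add sepcone_scaleR mat1_sepcone)
  then show ?thesis by simp
qed

text \<open>The cone consists of positive matrices, so the margin bounds the form of the density
  below by c times the squared norm. The kernel is therefore trivial.\<close>

lemma state_rank_full:
  fixes \<phi> :: "complex ^ ('k::finite \<times> 'h::finite) ^ ('k \<times> 'h) \<Rightarrow> complex"
  assumes "is_state \<phi>" "dens \<phi> - c *\<^sub>R mat 1 \<in> sepcone" "c > 0"
  shows "state_rank \<phi> = CARD('k) * CARD('h)"
proof -
  define d where "d = dens \<phi>"
  have "y = 0" if "d *v y = 0" for y
  proof -
    have "cip ((d - c *\<^sub>R mat 1) *v y) y \<in> \<real>\<^sub>\<ge>\<^sub>0"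
      using sepcone_psd[OF assms(2)] by (simp add: psd_def d_def)
    moreover have "(d - c *\<^sub>R mat 1) *v y = d *v y - of_real c *s y"
      by (simp add: matrix_vector_mult_diff_rdistrib matrix_vector_scaleR_left)
    ultimately have "- (of_real (c * (norm y)\<^sup>2)) \<in> (\<real>\<^sub>\<ge>\<^sub>0 :: complex set)"
      using that by (simp only: cip_diff_left cip_scale_left cip_self of_real_mult) simp
    then have "c * (norm y)\<^sup>2 \<le> 0"
      by (simp add: complex_nonneg_Reals_iff flip: of_real_mult of_real_power)
    then show ?thesis using assms(3) by (simp add: mult_le_0_iff)
  qed
  then have "vec.span (rows d) = UNIV"
    using matrix_left_invertible_ker[of d] matrix_left_invertible_span_rows_gen[of d] by blast
  then have "rank d = CARD('k \<times> 'h)"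
    unfolding row_rank_def_gen by (metis vec.dim_span vec_dim_card)
  moreover have "density \<phi> = d"
    using is_stateD(1)[OF assms(1)] by (metis d_def density_trace_functional)
  ultimately show ?thesis by (simp add: state_rank_def)
qed

section \<open>Pure states as extreme points\<close>

lemma cip_projection_orthogonal:
  assumes "cip \<psi> \<psi> = 1"
  shows "cip \<psi> (z - cip z \<psi> *s \<psi>) = 0"
  using assms by (simp add: cip_diff_right cip_scale_right cnj_cip)

text \<open>By \<open>psd_eq_0\<close>, P kills the orthogonal complement of \<psi>, so it is
  determined by P \<psi>. Self-adjointness makes P \<psi> a multiple of \<psi>, and the trace makes
  the multiple 1. This is what forces both ends of a segment through a pure state to
  coincide.\<close>

lemma psd_eq_outer:
  fixes P :: "complex ^ 'a ^ 'a"
  assumes P: "psd P" "trace P = 1" and \<psi>: "cip \<psi> \<psi> = 1"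
    and orth: "\<And>y. cip \<psi> y = 0 \<Longrightarrow> cip (P *v y) y = 0"
  shows "P = outer \<psi>"
proof -
  define u where "u = P *v \<psi>"
  have P0: "P *v y = 0" if "cip \<psi> y = 0" for y
    using psd_eq_0[OF P(1) orth[OF that]] .
  have Pz: "P *v z = cip z \<psi> *s u" for z
  proof -
    have "P *v (z - cip z \<psi> *s \<psi>) = 0"
      by (intro P0 cip_projection_orthogonal \<psi>)
    then show ?thesis
      by (simp add: matrix_vector_mult_diff_distrib matrix_vector_scale u_def)
  qed
  have entry: "P $ p $ q = cnj (\<psi> $ q) * u $ p" for p q
    using Pz[of "axis q 1"] matrix_vector_axis_component[of P q p] by simp
  define c where "c = cip u \<psi>"
  have "u = c *s \<psi>"
  proof -
    define y where "y = u - c *s \<psi>"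
    have y: "cip \<psi> y = 0" unfolding y_def c_def by (intro cip_projection_orthogonal \<psi>)
    then have "cip u y = 0"
      unfolding u_def by (simp add: psd_selfadjoint[OF P(1)] P0)
    with y have "cip y y = 0"
      by (subst y_def, simp add: cip_diff_left cip_scale_left)
    then show ?thesis by (simp add: cip_self_eq_0 y_def)
  qed
  then have *: "P $ p $ q = c * outer \<psi> $ p $ q" for p q
    by (simp add: entry outer_def)
  then have "trace P = c * trace (outer \<psi>)"
    by (simp add: trace_def sum_distrib_left)
  then have "c = 1" using P \<psi> by (simp add: trace_outer)
  then show ?thesis using * by (simp add: vec_eq_iff)
qed

text \<open>A pure state is an extreme point, so a separable one is itself a product state.\<close>

lemma pure_separable_product:
  fixes \<psi> :: "complex ^ ('k::finite \<times> 'h::finite)"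
  assumes \<psi>: "cip \<psi> \<psi> = 1" and hull: "outer \<psi> \<in> convex hull product_densities"
  obtains a b where "\<psi> = tensor_vec a b"
proof -
  have "outer \<psi> extreme_point_of (convex hull product_densities)"
    unfolding extreme_point_of_def
  proof (intro conjI ballI notI hull)
    fix a b :: "complex ^ ('k \<times> 'h) ^ ('k \<times> 'h)"
    assume ab: "a \<in> convex hull product_densities" "b \<in> convex hull product_densities" "outer \<psi> \<in> open_segment a b"
    then obtain r where r: "0 < r" "r < 1" "a \<noteq> b" and eq: "outer \<psi> = (1 - r) *\<^sub>R a + r *\<^sub>R b"
      by (auto simp: in_segment)
    have d: "psd a" "trace a = 1" "psd b" "trace b = 1"
      using ab hull_product_densities_subset by (auto simp: densities_def)
    have both: "cip (a *v y) y = 0 \<and> cip (b *v y) y = 0" if "cip \<psi> y = 0" for y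
    proof -
      have "cip (outer \<psi> *v y) y = 0"
        using that by (simp add: outer_mult cip_scale_left)
      then have "of_real (1 - r) * cip (a *v y) y + of_real r * cip (b *v y) y = 0"
        unfolding eq matrix_vector_mult_add_rdistrib matrix_vector_scaleR_left cip_add_left cip_scale_left .
      moreover have "cip (a *v y) y \<in> \<real>\<^sub>\<ge>\<^sub>0" "cip (b *v y) y \<in> \<real>\<^sub>\<ge>\<^sub>0"
        using d by (auto simp: psd_def)
      ultimately show ?thesis
        using r by (auto simp: complex_nonneg_Reals_iff complex_eq_iff add_nonneg_eq_0_iff)
    qed
    have "a = outer \<psi>" "b = outer \<psi>"
      using d \<psi> both by (auto intro!: psd_eq_outer)
    with r show False by simp
  qed
  then have "outer \<psi> \<in> product_densities" by (rule extreme_point_of_convex_hull)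
  then obtain s t where st: "outer \<psi> = s \<otimes> t" by (auto simp: product_densities_def)
  have "\<psi> \<noteq> 0" using \<psi> by auto
  then obtain p where p: "\<psi> $ p \<noteq> 0" by (auto simp: vec_eq_iff)
  \<comment> \<open>Column p of \<open>outer \<psi>\<close> is \<psi> times a nonzero number; the
    same column of s \<otimes> t is a product vector.\<close>
  have "\<psi> = tensor_vec (\<chi> a. s $ a $ fst p / cnj (\<psi> $ p)) (\<chi> b. t $ b $ snd p)"
  proof -
    have "\<psi> $ q * cnj (\<psi> $ p) = s $ fst q $ fst p * t $ snd q $ snd p" for q
      using arg_cong[OF st, of "\<lambda>d. d $ q $ p"] by (simp add: outer_def otimes_def)
    then show ?thesis using p by (simp add: vec_eq_iff tensor_vec_def field_simps)
  qed
  then show ?thesis by (rule that)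
qed

section \<open>Extensions of a faithful state\<close>

text \<open>Reads a vector of the tensor product as a family of vectors of the second factor: 1
  \<otimes> b acts on every row separately, and a \<otimes> 1 forms linear combinations of
  rows.\<close>

definition vrow :: "complex ^ ('a::finite \<times> 'b::finite) \<Rightarrow> 'a \<Rightarrow> complex ^ 'b" where
  "vrow \<xi> i = (\<chi> h. \<xi> $ (i, h))"

lemma vrow_mat1_otimes: "vrow ((mat 1 \<otimes> b) *v \<xi>) i = b *v vrow \<xi> i"
proof -
  have "((mat 1 \<otimes> b) *v \<xi>) $ (i, h) = (\<Sum>j\<in>UNIV. if i = j then (\<Sum>h'\<in>UNIV. b $ h $ h' * \<xi> $ (j, h')) else 0)" for h
    unfolding matrix_vector_mult_def sum_prod_UNIV vec_lambda_beta
    by (intro sum.cong refl) (auto simp: otimes_def mat_def)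
  then show ?thesis by (simp add: vec_eq_iff vrow_def matrix_vector_mult_def)
qed

lemma vrow_otimes_mat1: "vrow ((a \<otimes> mat 1) *v \<xi>) x = (\<Sum>i\<in>UNIV. a $ x $ i *s vrow \<xi> i)"
proof -
  have "((a \<otimes> mat 1) *v \<xi>) $ (x, h) = (\<Sum>i\<in>UNIV. \<Sum>h'\<in>UNIV. if h = h' then a $ x $ i * \<xi> $ (i, h') else 0)" for h
    unfolding matrix_vector_mult_def sum_prod_UNIV vec_lambda_beta
    by (intro sum.cong refl) (auto simp: otimes_def mat_def)
  then show ?thesis by (simp add: vec_eq_iff vrow_def)
qed

lemma cip_vrow: "cip \<xi> \<eta> = (\<Sum>i\<in>UNIV. cip (vrow \<xi> i) (vrow \<eta> i))"
  by (simp add: cip_def vrow_def sum_prod_UNIV)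

lemma mat1_otimes_mat1: "mat 1 \<otimes> mat 1 = mat 1"
  by (auto simp: vec_eq_iff otimes_def mat_def prod_eq_iff)

lemma represents_dens:
  assumes "represents \<xi> \<omega>"
  shows "dens \<omega> = (\<Sum>i\<in>UNIV. outer (vrow \<xi> i))"
proof -
  have "\<omega> = trace_functional (\<Sum>i\<in>UNIV. outer (vrow \<xi> i))"
    using assms by (auto simp: represents_def trace_functional_sum_left trace_functional_outer cip_vrow vrow_mat1_otimes)
  then show ?thesis by simp
qed

text \<open>Purification: the rows of \<xi> are the vectors of a rank-one decomposition of the
  density. Faithfulness makes the matrix M of these rows injective, hence invertible, and this gives
  cyclicity. It supplies a vector for the topological claims, which mention none.\<close>

lemma exists_represents:
  fixes \<omega> :: "complex ^ 'h ^ 'h \<Rightarrow> complex"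
  assumes \<omega>: "is_state \<omega>" "faithful \<omega>"
  obtains \<xi> where "represents \<xi> \<omega>"
proof -
  obtain L :: "'h \<Rightarrow> complex ^ 'h" where L: "dens \<omega> = (\<Sum>i\<in>UNIV. outer (L i))"
    using is_stateD(2)[OF \<omega>(1)] by (rule psd_sum_outer)
  define \<xi> where "\<xi> = (\<chi> p. L (fst p) $ snd p)"
  have row: "vrow \<xi> i = L i" for i by (simp add: vrow_def \<xi>_def vec_eq_iff)
  define M where "M = (\<chi> i. L i)"
  have "y = 0" if "M *v y = 0" for y
  proof -
    \<comment> \<open>\<open>cip\<close> conjugates its second argument and M does not, so a kernel
      vector of M has to be conjugated to be orthogonal to all rows.\<close>
    define z where "z = (\<chi> h. cnj (y $ h))"
    have "cip z (L i) = cnj ((M *v y) $ i)" for i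
      by (simp add: cip_def z_def M_def matrix_vector_mult_def mult.commute)
    then have "cip z (L i) = 0" for i using that by simp
    then have "dens \<omega> *v z = 0"
      by (simp add: L matrix_vector_sum outer_mult)
    then have "z = 0" using faithful_pos[OF \<omega>, of z] by auto
    then show ?thesis by (simp add: z_def vec_eq_iff)
  qed
  then obtain B where "B ** M = mat 1" using matrix_left_invertible_ker[of M] by blast
  then have B: "M ** B = mat 1" by (simp add: matrix_left_right_inverse)
  have "\<exists>b. \<eta> = ((mat 1 :: complex ^ 'h ^ 'h) \<otimes> b) *v \<xi>" for \<eta>
  proof
    \<comment> \<open>Coordinate h of all rows of (1 \<otimes> b) \<xi> together is M applied to row
      h of b, so each row of b solves one linear system.\<close>
    define b where "b = (\<chi> h. B *v (\<chi> i. \<eta> $ (i, h)))"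
    have "vrow ((mat 1 \<otimes> b) *v \<xi>) i $ h = \<eta> $ (i, h)" for i h
    proof -
      have "vrow ((mat 1 \<otimes> b) *v \<xi>) i $ h = (M *v (b $ h)) $ i"
        unfolding vrow_mat1_otimes row by (simp add: matrix_vector_mult_def M_def mult.commute)
      also have "M *v (b $ h) = (\<chi> i. \<eta> $ (i, h))"
        by (simp add: b_def matrix_vector_mul_assoc B)
      finally show ?thesis by simp
    qed
    then show "\<eta> = ((mat 1 :: complex ^ 'h ^ 'h) \<otimes> b) *v \<xi>"
      by (auto simp: vec_eq_iff vrow_def)
  qed
  moreover have "\<omega> b = cip (((mat 1 :: complex ^ 'h ^ 'h) \<otimes> b) *v \<xi>) \<xi>" for b
  proof -
    have "\<omega> b = trace_functional (\<Sum>i\<in>UNIV. outer (L i)) b"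
      using fun_cong[OF is_stateD(1)[OF \<omega>(1)], of b] L by simp
    then show ?thesis
      by (simp add: trace_functional_sum_left trace_functional_outer cip_vrow vrow_mat1_otimes row)
  qed
  ultimately have "represents \<xi> \<omega>" unfolding represents_def by blast
  then show ?thesis by (rule that)
qed

lemma rho_trace_functional: "rho \<xi> v = trace_functional (\<Sum>k\<in>UNIV. outer ((v $ k \<otimes> mat 1) *v \<xi>))"
  by (rule ext) (simp add: rho_def trace_functional_sum_left trace_functional_outer)

lemma tuple_space_iff:
  "v \<in> tuple_space \<longleftrightarrow>
    (\<forall>i j. (\<Sum>k\<in>UNIV. \<Sum>x\<in>UNIV. cnj (v $ k $ x $ i) * v $ k $ x $ j) = (if i = j then 1 else 0))"
  by (simp add: tuple_space_def vec_eq_iff adj_def matrix_matrix_mult_def mat_def)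

lemma cip_matrix_sum:
  fixes b :: "complex ^ 'h ^ 'h"
  shows "cip (b *v (\<Sum>i\<in>I. c i *s r i)) (\<Sum>j\<in>I. c j *s r j) =
    (\<Sum>i\<in>I. \<Sum>j\<in>I. (cnj (c j) * c i) * cip (b *v r i) (r j))"
proof -
  have 1: "b *v (\<Sum>i\<in>I. c i *s r i) = (\<Sum>i\<in>I. c i *s (b *v r i))"
    by (induction I rule: infinite_finite_induct)
      (auto simp: matrix_vector_right_distrib matrix_vector_scale)
  have 2: "cip x (\<Sum>j\<in>I. c j *s r j) = (\<Sum>j\<in>I. cnj (c j) * cip x (r j))" for x
    by (induction I rule: infinite_finite_induct) (auto simp: cip_add_right cip_scale_right)
  show ?thesis
    unfolding 1 cip_sum_left cip_scale_left 2
    by (simp add: sum_distrib_left ac_simps) (rule sum.swap)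
qed

text \<open>1 \<otimes> b commutes with every v_k \<otimes> 1, so the marginal sees v only through
  the sum of \<open>adj (v $ k) ** (v $ k)\<close>, which is the identity. The exchanges of sums
  bring k and x innermost, where this relation applies in coordinates.\<close>

lemma rho_marginal:
  assumes v: "v \<in> tuple_space"
  shows "rho \<xi> v (mat 1 \<otimes> b) = cip ((mat 1 \<otimes> b) *v \<xi>) \<xi>"
proof -
  define c where "c i j = cip (b *v vrow \<xi> i) (vrow \<xi> j)" for i j
  have "rho \<xi> v (mat 1 \<otimes> b) =
      (\<Sum>k\<in>UNIV. \<Sum>x\<in>UNIV. \<Sum>i\<in>UNIV. \<Sum>j\<in>UNIV. cnj (v $ k $ x $ j) * v $ k $ x $ i * c i j)"
    unfolding rho_def cip_vrow vrow_mat1_otimes vrow_otimes_mat1 cip_matrix_sum c_def ..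
  also have "\<dots> = (\<Sum>k\<in>UNIV. \<Sum>i\<in>UNIV. \<Sum>x\<in>UNIV. \<Sum>j\<in>UNIV. cnj (v $ k $ x $ j) * v $ k $ x $ i * c i j)"
    by (intro sum.cong refl sum.swap)
  also have "\<dots> = (\<Sum>i\<in>UNIV. \<Sum>k\<in>UNIV. \<Sum>j\<in>UNIV. \<Sum>x\<in>UNIV. cnj (v $ k $ x $ j) * v $ k $ x $ i * c i j)"
    by (subst sum.swap) (intro sum.cong refl sum.swap)
  also have "\<dots> = (\<Sum>i\<in>UNIV. \<Sum>j\<in>UNIV. \<Sum>k\<in>UNIV. \<Sum>x\<in>UNIV. cnj (v $ k $ x $ j) * v $ k $ x $ i * c i j)"
    by (intro sum.cong refl sum.swap)
  also have "\<dots> = (\<Sum>i\<in>UNIV. \<Sum>j\<in>UNIV. (\<Sum>k\<in>UNIV. \<Sum>x\<in>UNIV. cnj (v $ k $ x $ j) * v $ k $ x $ i) * c i j)"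
    by (simp only: sum_distrib_right)
  also have "\<dots> = (\<Sum>i\<in>UNIV. \<Sum>j\<in>UNIV. if j = i then c i j else 0)"
    using v unfolding tuple_space_iff by (intro sum.cong refl) simp
  also have "\<dots> = (\<Sum>i\<in>UNIV. c i i)"
    by simp
  finally show ?thesis
    by (simp add: c_def cip_vrow[of _ \<xi>] vrow_mat1_otimes)
qed

lemma rank_le_card: "rank (d :: complex ^ 'a ^ 'b) \<le> CARD('a)"
  unfolding row_rank_def_gen by (metis vec.dim_subset subset_UNIV vec_dim_card)

text \<open>Normalization is the marginal condition at b = 1, and the rank bound is the size of the
  matrix.\<close>

lemma rho_extensions:
  fixes v :: "complex ^ 'h ^ 'k ^ 'r"
  assumes \<omega>: "is_state \<omega>" "represents \<xi> \<omega>" and v: "v \<in> tuple_space"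
  shows "rho \<xi> v \<in> extensions (CARD('k) * CARD('h)) \<omega>"
proof -
  have marg: "rho \<xi> v (mat 1 \<otimes> b) = \<omega> b" for b
    using \<omega>(2) rho_marginal[OF v, of \<xi> b] by (simp add: represents_def)
  have "rho \<xi> v (mat 1) = 1"
    using marg[of "mat 1"] \<omega>(1) by (simp add: mat1_otimes_mat1 is_state_def)
  then have "is_state (rho \<xi> v)"
    unfolding rho_trace_functional by (intro is_state_trace_functional psd_sum psd_outer) (simp add: trace_functional_mat1)
  moreover have "state_rank (rho \<xi> v) \<le> CARD('k) * CARD('h)"
    unfolding state_rank_def using rank_le_card[of "density (rho \<xi> v)"] by simp
  ultimately show ?thesis using marg by (simp add: extensions_def)
qed

lemma exists_rho_entangled:
  fixes \<xi> :: "complex ^ ('h::finite \<times> 'h)"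
  assumes \<omega>: "is_state \<omega>" "represents \<xi> \<omega>"
    and card: "CARD('h) \<le> CARD('k)" "CARD('h) \<ge> 2"
  obtains v :: "complex ^ 'h ^ 'k ^ 'r::finite" where "v \<in> tuple_space" "entangled (rho \<xi> v)"
proof -
  obtain \<iota> :: "'h \<Rightarrow> 'k" where \<iota>: "inj \<iota>"
    using card_le_inj[of "UNIV :: 'h set" "UNIV :: 'k set"] card by auto
  obtain k0 :: 'r where True by simp
  define V :: "complex ^ 'h ^ 'k" where "V = (\<chi> x i. if x = \<iota> i then 1 else 0)"
  define v :: "complex ^ 'h ^ 'k ^ 'r" where "v = (\<chi> k. if k = k0 then V else 0)"
  define \<psi> where "\<psi> = (V \<otimes> mat 1) *v \<xi>"
  have v: "v \<in> tuple_space"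
    unfolding tuple_space_iff
  proof (intro allI)
    fix i j
    have "(\<Sum>k\<in>UNIV. \<Sum>x\<in>UNIV. cnj (v $ k $ x $ i) * v $ k $ x $ j) =
      (\<Sum>k\<in>UNIV. \<Sum>x\<in>UNIV. if k = k0 then (if x = \<iota> i then (if i = j then 1 else 0) else 0) else 0)"
      using inj_eq[OF \<iota>] by (intro sum.cong refl) (auto simp: v_def V_def)
    also have "\<dots> = (\<Sum>k\<in>UNIV. if k = k0 then (\<Sum>x\<in>UNIV. if x = \<iota> i then (if i = j then 1 else 0) else 0) else 0)"
      by (intro sum.cong refl) simp
    finally show "(\<Sum>k\<in>UNIV. \<Sum>x\<in>UNIV. cnj (v $ k $ x $ i) * v $ k $ x $ j) = (if i = j then 1 else 0)"
      by simp
  qed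
  have "(\<Sum>k\<in>UNIV. outer ((v $ k \<otimes> mat 1) *v \<xi>)) = (\<Sum>k\<in>UNIV. if k = k0 then outer \<psi> else 0)"
    by (intro sum.cong refl) (auto simp: v_def \<psi>_def otimes_def outer_def vec_eq_iff matrix_vector_mult_def)
  then have rho: "rho \<xi> v = trace_functional (outer \<psi>)" by (simp add: rho_trace_functional)
  have st: "is_state (rho \<xi> v)"
    using rho_extensions[OF \<omega> v] by (simp add: extensions_def)
  have row: "vrow \<psi> (\<iota> i) = vrow \<xi> i" for i
  proof -
    have "vrow \<psi> (\<iota> i) = (\<Sum>j\<in>UNIV. if j = i then vrow \<xi> j else 0)"
      unfolding \<psi>_def vrow_otimes_mat1 using inj_eq[OF \<iota>] by (intro sum.cong refl) (auto simp: V_def)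
    then show ?thesis by simp
  qed
  have "\<not> separable_state (rho \<xi> v)"
  proof
    assume "separable_state (rho \<xi> v)"
    then have "outer \<psi> \<in> convex hull product_densities"
      by (simp add: separable_state_iff rho)
    moreover have "cip \<psi> \<psi> = 1"
      using st by (simp add: rho is_state_iff trace_outer)
    ultimately obtain a b where ab: "\<psi> = tensor_vec a b" by (metis pure_separable_product)
    have \<xi>: "vrow \<xi> i = a $ \<iota> i *s b" for i
      by (simp flip: row) (simp add: ab vrow_def tensor_vec_def vec_eq_iff)
    obtain i j :: 'h where "i \<noteq> j"
      using card(2) by (metis card_2_iff' ex_card UNIV_I)
    \<comment> \<open>The rows of \<xi> reappear among the rows of \<psi>, so a product vector
      \<psi> would make them all proportional. Then the rows of every (1 \<otimes> c) \<xi> are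
      proportional too, whereas by cyclicity \<eta>, the identity matrix read as a vector, is of
      this form.\<close>
    define \<eta> :: "complex ^ ('h \<times> 'h)" where "\<eta> = (\<chi> p. if fst p = snd p then 1 else 0)"
    have "\<eta> \<in> range (\<lambda>b :: complex ^ 'h ^ 'h. ((mat 1 :: complex ^ 'h ^ 'h) \<otimes> b) *v \<xi>)"
      using \<omega>(2) by (simp add: represents_def)
    then obtain c :: "complex ^ 'h ^ 'h" where c: "\<eta> = ((mat 1 :: complex ^ 'h ^ 'h) \<otimes> c) *v \<xi>"
      by blast
    have "\<eta> $ (i, h) = a $ \<iota> i * (c *v b) $ h" for i h
      using arg_cong[OF c, of "\<lambda>x. vrow x i $ h"]
      by (simp add: vrow_mat1_otimes \<xi> matrix_vector_scale) (simp add: vrow_def)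
    from this[of i i] this[of i j] this[of j j] \<open>i \<noteq> j\<close> show False
      by (auto simp: \<eta>_def)
  qed
  with st have "entangled (rho \<xi> v)" by (simp add: entangled_def)
  with v show ?thesis by (rule that)
qed

text \<open>c is the minimum of the quadratic form over the compact unit sphere; faithfulness makes
  it positive.\<close>

lemma faithful_lower_bound:
  fixes \<omega> :: "complex ^ 'h ^ 'h \<Rightarrow> complex"
  assumes \<omega>: "is_state \<omega>" "faithful \<omega>"
  obtains c where "c > 0" "psd (dens \<omega> - c *\<^sub>R mat 1)"
proof -
  define q where "q y = Re (cip (dens \<omega> *v y) y)" for y
  have q: "cip (dens \<omega> *v y) y = of_real (q y)" "q y \<ge> 0" for y
    using is_stateD(2)[OF \<omega>(1)] by (auto simp: psd_def complex_nonneg_Reals_iff q_def complex_eq_iff)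
  have "\<exists>x\<in>sphere 0 1. \<forall>y\<in>sphere 0 1. q x \<le> q y"
  proof (rule continuous_attains_inf)
    show "sphere 0 1 \<noteq> ({} :: (complex ^ 'h) set)" by simp
    show "continuous_on (sphere 0 1) q"
      unfolding q_def
      by (intro continuous_on_Re continuous_on_cip continuous_on_matrix_vector_mult continuous_on_id continuous_on_const)
  qed simp
  then obtain x where x: "norm x = 1" "\<And>y. norm y = 1 \<Longrightarrow> q x \<le> q y" by auto
  have "x \<noteq> 0" using x(1) by auto
  then have "q x \<noteq> 0"
    using faithful_pos[OF \<omega>, of x] q(1)[of x] by auto
  then have pos: "q x > 0" using q(2)[of x] by simp
  have "psd (dens \<omega> - q x *\<^sub>R mat 1)"
    unfolding psd_def
  proof
    fix y :: "complex ^ 'h"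
    have "q x * (norm y)\<^sup>2 \<le> q y"
    proof (cases "y = 0")
      case True
      then show ?thesis by (simp add: q_def)
    next
      case False
      define z where "z = of_real (1 / norm y) *s y"
      have z: "y = of_real (norm y) *s z" using False by (simp add: z_def)
      have "cip z z = 1"
        unfolding z_def cip_scale_left cip_scale_right cip_self[of y] using False
        by (simp add: power2_eq_square)
      then have "norm z = 1" unfolding cip_self by (simp add: abs_square_eq_1 flip: of_real_power)
      have "complex_of_real (q y) = of_real ((norm y)\<^sup>2 * q z)"
        by (subst q(1)[symmetric], subst (1 2) z)
          (simp add: matrix_vector_scale cip_scale_left cip_scale_right q(1) power2_eq_square del: vector_smult_assoc)
      then have "q y = (norm y)\<^sup>2 * q z" by (simp only: of_real_eq_iff)
      with x(2)[OF \<open>norm z = 1\<close>] show ?thesis by (simp add: mult.commute mult_right_mono)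
    qed
    moreover have "cip ((dens \<omega> - q x *\<^sub>R mat 1) *v y) y = of_real (q y - q x * (norm y)\<^sup>2)"
      by (simp add: matrix_vector_mult_diff_rdistrib matrix_vector_scaleR_left cip_diff_left cip_scale_left q(1) cip_self)
    ultimately show "cip ((dens \<omega> - q x *\<^sub>R mat 1) *v y) y \<in> \<real>\<^sub>\<ge>\<^sub>0"
      by (simp only: nonneg_Reals_of_real_iff)
  qed
  with pos show ?thesis by (rule that)
qed

lemma mat1_otimes_outer:
  "(mat 1 :: complex ^ 'k ^ 'k) \<otimes> (\<Sum>i\<in>I. outer (w i)) = (\<Sum>x\<in>UNIV. \<Sum>i\<in>I. outer (tensor_vec (axis x 1) (w i)))"
proof -
  have "(\<Sum>x\<in>UNIV. \<Sum>i\<in>I. outer (tensor_vec (axis x 1) (w i)) $ p $ q) =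
     (\<Sum>x\<in>UNIV. if x = fst p then (if fst p = fst q then (\<Sum>i\<in>I. outer (w i) $ snd p $ snd q) else 0) else 0)"
    for p q :: "'k \<times> 'a"
    by (intro sum.cong refl) (auto simp: outer_def tensor_vec_def axis_def)
  then show ?thesis by (auto simp: vec_eq_iff otimes_def mat_def)
qed

lemma tensor_matrix_unit_apply: "((matrix_unit x i \<otimes> mat 1) *v \<xi>) = tensor_vec (axis x 1) (vrow \<xi> i)"
proof -
  have "vrow ((matrix_unit x i \<otimes> mat 1) *v \<xi>) y = (\<Sum>j\<in>UNIV. if j = i then (if y = x then vrow \<xi> i else 0) else 0)" for y
    unfolding vrow_otimes_mat1 by (intro sum.cong refl) (auto simp: matrix_unit_def)
  then show ?thesis
    by (auto simp: vec_eq_iff vrow_def tensor_vec_def axis_def)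
qed

text \<open>One tuple entry per matrix unit from H to K, which is why \<open>'r\<close> must have
  CARD('k) * CARD('h) elements. The resulting density is 1 \<otimes> dens \<omega> divided by
  m.\<close>

lemma exists_rho_separable_interior:
  fixes \<xi> :: "complex ^ ('h::finite \<times> 'h)"
  assumes \<omega>: "is_state \<omega>" "faithful \<omega>" "represents \<xi> \<omega>"
    and card: "CARD('r::finite) = CARD('k) * CARD('h)"
  obtains v :: "complex ^ 'h ^ 'k ^ 'r" and \<epsilon> where "v \<in> tuple_space" "\<epsilon> > 0"
    "dens (rho \<xi> v) - \<epsilon> *\<^sub>R mat 1 \<in> sepcone"
proof -
  obtain c where c: "c > 0" "psd (dens \<omega> - c *\<^sub>R mat 1)"
    using faithful_lower_bound[OF \<omega>(1,2)] .
  obtain L :: "'h \<Rightarrow> complex ^ 'h" where L: "dens \<omega> - c *\<^sub>R mat 1 = (\<Sum>i\<in>UNIV. outer (L i))"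
    using psd_sum_outer[OF c(2)] .
  obtain \<beta> :: "'r \<Rightarrow> 'k \<times> 'h" where \<beta>: "bij \<beta>"
    using card by (metis card_cartesian_product UNIV_Times_UNIV finite bij_betw_iff_card)
  define m where "m = real CARD('k)"
  have m: "m > 0" by (simp add: m_def)
  \<comment> \<open>The products of the adjoint of a matrix unit with itself add up to m times the
    identity of H; the factor 1 / sqrt m restores 1.\<close>
  define v :: "complex ^ 'h ^ 'k ^ 'r"
    where "v = (\<chi> k x i. of_real (1 / sqrt m) * matrix_unit (fst (\<beta> k)) (snd (\<beta> k)) $ x $ i)"
  have "1 / sqrt m * (1 / sqrt m) = 1 / m" using m by simp
  then have m2: "complex_of_real (1 / m) = of_real (1 / sqrt m) * of_real (1 / sqrt m)"
    by (metis of_real_mult)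
  have "v \<in> tuple_space"
    unfolding tuple_space_iff
  proof (intro allI)
    fix i j
    define g where "g p = (\<Sum>x\<in>UNIV. of_real (1 / m) *
      (cnj (matrix_unit (fst p) (snd p) $ x $ i) * matrix_unit (fst p) (snd p) $ x $ j))" for p :: "'k \<times> 'h"
    have "(\<Sum>k\<in>UNIV. \<Sum>x\<in>UNIV. cnj (v $ k $ x $ i) * v $ k $ x $ j) = (\<Sum>k\<in>UNIV. g (\<beta> k))"
      unfolding g_def m2 v_def by (simp only: vec_lambda_beta complex_cnj_mult complex_cnj_complex_of_real ac_simps)
    also have "\<dots> = (\<Sum>p\<in>UNIV. g p)"
      using \<beta> by (rule sum.reindex_bij_betw)
    also have "\<dots> = (\<Sum>y\<in>(UNIV :: 'k set). \<Sum>i'\<in>UNIV. \<Sum>x\<in>UNIV. if x = y then (if i' = i then (if i = j then of_real (1 / m) else 0) else 0) else 0)"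
      unfolding sum_prod_UNIV g_def by (intro sum.cong refl) (auto simp: matrix_unit_def)
    also have "\<dots> = (if i = j then 1 else 0)"
      using m by (simp add: m_def)
    finally show "(\<Sum>k\<in>UNIV. \<Sum>x\<in>UNIV. cnj (v $ k $ x $ i) * v $ k $ x $ j) = (if i = j then 1 else 0)" .
  qed
  moreover have "c / m > 0" using c m by simp
  \<comment> \<open>Subtracting the margin only replaces \<open>dens \<omega>\<close> by dens
    \<omega> - c 1, which is still positive and so a sum of rank-one pieces; tensored with the
    identity they become product vectors.\<close>
  moreover have "dens (rho \<xi> v) - (c / m) *\<^sub>R mat 1 \<in> sepcone"
  proof -
    have vk: "(v $ k \<otimes> mat 1) *v \<xi> = of_real (1 / sqrt m) *s tensor_vec (axis (fst (\<beta> k)) 1) (vrow \<xi> (snd (\<beta> k)))" for k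
    proof -
      have "(v $ k \<otimes> mat 1) *v \<xi> = of_real (1 / sqrt m) *s ((matrix_unit (fst (\<beta> k)) (snd (\<beta> k)) \<otimes> mat 1) *v \<xi>)"
        unfolding vec_eq_iff
        by (simp add: v_def otimes_def matrix_vector_mult_def sum_distrib_left ac_simps)
      then show ?thesis by (simp only: tensor_matrix_unit_apply)
    qed
    define g where "g p = (1 / m) *\<^sub>R outer (tensor_vec (axis (fst p) 1) (vrow \<xi> (snd p)))" for p :: "'k \<times> 'h"
    have "dens (rho \<xi> v) = (\<Sum>k\<in>UNIV. g (\<beta> k))"
      unfolding rho_trace_functional dens_trace_functional vk outer_scale g_def using m by (simp add: power_divide)
    also have "\<dots> = (\<Sum>p\<in>UNIV. g p)"
      using \<beta> by (rule sum.reindex_bij_betw)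
    also have "\<dots> = (1 / m) *\<^sub>R (\<Sum>x\<in>UNIV. \<Sum>i\<in>UNIV. outer (tensor_vec (axis x 1) (vrow \<xi> i)))"
      by (simp add: sum_prod_UNIV scaleR_sum_right g_def)
    also have "\<dots> = (1 / m) *\<^sub>R (mat 1 \<otimes> dens \<omega>)"
      by (simp only: represents_dens[OF \<omega>(3)] mat1_otimes_outer)
    finally have "dens (rho \<xi> v) - (c / m) *\<^sub>R mat 1 = (1 / m) *\<^sub>R (mat 1 \<otimes> dens \<omega>) - (c / m) *\<^sub>R (mat 1 \<otimes> mat 1)"
      by (simp add: mat1_otimes_mat1)
    also have "\<dots> = (1 / m) *\<^sub>R (mat 1 \<otimes> (dens \<omega> - c *\<^sub>R mat 1))"
      by (simp add: vec_eq_iff otimes_def algebra_simps scaleR_conv_of_real[where 'a = complex])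
    also have "\<dots> \<in> sepcone"
      unfolding L mat1_otimes_outer using m
      by (intro sepcone_scaleR sepcone_sum outer_tensor_vec_sepcone) simp
    finally show ?thesis .
  qed
  ultimately show ?thesis by (rule that)
qed

section \<open>The invariant measure on tuples\<close>

text \<open>W is 1 - u u* / c. In both products with its adjoint the coefficient of u u* is minus (1
  / c + 1 / cnj c) plus the squared norm of u over c cnj c, and the hypothesis on the norm makes it
  vanish. A complex c is needed because the inner product of two unit vectors need not be
  real.\<close>

lemma reflection_unitary:
  fixes U :: "'p::finite \<Rightarrow> complex" and c :: complex
  assumes N: "(\<Sum>p\<in>UNIV. U p * cnj (U p)) = c + cnj c"
  defines "W \<equiv> \<lambda>p q. (if p = q then 1 else 0) - U p * cnj (U q) / c"
  shows "(\<Sum>p\<in>UNIV. cnj (W p q) * W p q') = (if q = q' then 1 else 0)"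
    and "(\<Sum>p\<in>UNIV. W q p * cnj (W q' p)) = (if q = q' then 1 else 0)"
proof -
  have coeff: "1 / c + 1 / cnj c = (c + cnj c) / (c * cnj c)"
    by (cases "c = 0") (simp_all add: field_simps)
  define K where "K q q' = U q * cnj (U q') / (c * cnj c)" for q q'
  have sumK: "(\<Sum>p\<in>UNIV. K q q' * (U p * cnj (U p))) = K q q' * (c + cnj c)" for q q'
    by (simp only: N flip: sum_distrib_left)
  have "cnj (W p q) * W p q' = (if p = q then if q = q' then 1 else 0 else 0)
      - (if p = q then U q * cnj (U q') / c else 0) - (if p = q' then U q * cnj (U q') / cnj c else 0)
      + K q q' * (U p * cnj (U p))" for p
    by (simp add: W_def K_def algebra_simps)
  then have "(\<Sum>p\<in>UNIV. cnj (W p q) * W p q') = (if q = q' then 1 else 0)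
     - U q * cnj (U q') / c - U q * cnj (U q') / cnj c
     + K q q' * (c + cnj c)"
    by (simp add: sum.distrib sum_subtractf sumK)
  also have "\<dots> = (if q = q' then 1 else 0) - U q * cnj (U q') * ((1 / c + 1 / cnj c) - (c + cnj c) / (c * cnj c))"
    by (simp add: K_def algebra_simps)
  finally show "(\<Sum>p\<in>UNIV. cnj (W p q) * W p q') = (if q = q' then 1 else 0)"
    by (simp only: coeff) simp
  have "W q p * cnj (W q' p) = (if p = q then if q = q' then 1 else 0 else 0)
      - (if p = q' then U q * cnj (U q') / c else 0) - (if p = q then U q * cnj (U q') / cnj c else 0)
      + K q q' * (U p * cnj (U p))" for p
    by (simp add: W_def K_def algebra_simps)
  then have "(\<Sum>p\<in>UNIV. W q p * cnj (W q' p)) = (if q = q' then 1 else 0)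
     - U q * cnj (U q') / c - U q * cnj (U q') / cnj c
     + K q q' * (c + cnj c)"
    by (simp add: sum.distrib sum_subtractf sumK)
  also have "\<dots> = (if q = q' then 1 else 0) - U q * cnj (U q') * ((1 / c + 1 / cnj c) - (c + cnj c) / (c * cnj c))"
    by (simp add: K_def algebra_simps)
  finally show "(\<Sum>p\<in>UNIV. W q p * cnj (W q' p)) = (if q = q' then 1 else 0)"
    by (simp only: coeff) simp
qed

text \<open>Stacks the r blocks, so that a tuple becomes a map from H to the direct sum of r copies
  of K; the tuple condition then says that its columns are orthonormal.\<close>

definition column_vec :: "complex ^ 'h ^ 'k ^ 'r \<Rightarrow> 'h \<Rightarrow> complex ^ ('r::finite \<times> 'k::finite)" where
  "column_vec v h = (\<chi> p. v $ fst p $ snd p $ h)"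

lemma tuple_space_columns:
  "v \<in> tuple_space \<longleftrightarrow> (\<forall>i j. cip (column_vec v j) (column_vec v i) = (if i = j then 1 else 0))"
  unfolding tuple_space_iff cip_def column_vec_def sum_prod_UNIV by (simp add: mult.commute)

lemma column_vec_inject: "(\<And>h. column_vec v h = column_vec v' h) \<Longrightarrow> v = v'"
  by (auto simp: vec_eq_iff column_vec_def)

definition block_matrix :: "('r \<times> 'k \<Rightarrow> 'r \<times> 'k \<Rightarrow> complex) \<Rightarrow> complex ^ 'k ^ 'k ^ 'r ^ 'r" where
  "block_matrix W = (\<chi> i j x y. W (i, x) (j, y))"

lemma block_unitary_matrix:
  assumes "\<And>q q'. (\<Sum>p\<in>UNIV. cnj (W p q) * W p q') = (if q = q' then 1 else 0)"
    and "\<And>q q'. (\<Sum>p\<in>UNIV. W q p * cnj (W q' p)) = (if q = q' then 1 else 0)"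
  shows "block_unitary (block_matrix W)"
proof -
  have "(\<Sum>k\<in>UNIV. \<Sum>z\<in>UNIV. cnj (W (k, z) (i, x)) * W (k, z) (j, y)) = (if i = j \<and> x = y then 1 else 0)"
    "(\<Sum>k\<in>UNIV. \<Sum>z\<in>UNIV. W (i, x) (k, z) * cnj (W (j, y) (k, z))) = (if i = j \<and> x = y then 1 else 0)"
    for i x j y
    using assms[of "(i, x)" "(j, y)"] unfolding sum_prod_UNIV by simp_all
  then show ?thesis
    by (simp add: block_unitary_def block_matrix_def vec_eq_iff matrix_matrix_mult_def adj_def mat_def)
qed

lemma block_act_column:
  "column_vec (block_act (block_matrix W) v) h $ p = (\<Sum>q\<in>UNIV. W p q * column_vec v h $ q)"
  by (simp add: column_vec_def block_act_def block_matrix_def matrix_matrix_mult_def sum_prod_UNIV)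

lemma block_act_tuple_space:
  assumes w: "block_unitary w" and v: "v \<in> tuple_space"
  shows "block_act w v \<in> tuple_space"
proof -
  define W where "W p q = w $ fst p $ fst q $ snd p $ snd q" for p q
  have wW: "w = block_matrix W" by (simp add: block_matrix_def W_def vec_eq_iff)
  have W: "(\<Sum>p\<in>UNIV. W p q * cnj (W p q')) = (if q' = q then 1 else 0)" for q q'
  proof -
    have "(\<Sum>k\<in>UNIV. adj (w $ k $ fst q') ** (w $ k $ fst q)) $ snd q' $ snd q = (if fst q' = fst q then mat 1 else 0) $ snd q' $ snd q"
      using w by (simp add: block_unitary_def)
    then show ?thesis
      unfolding sum_prod_UNIV
      by (auto simp: W_def matrix_matrix_mult_def adj_def mat_def mult.commute prod_eq_iff)
  qed
  have "cip (column_vec (block_act w v) j) (column_vec (block_act w v) i) = cip (column_vec v j) (column_vec v i)" for i j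
  proof -
    have "cip (column_vec (block_act w v) j) (column_vec (block_act w v) i) =
       (\<Sum>p\<in>UNIV. \<Sum>q\<in>UNIV. \<Sum>q'\<in>UNIV. (column_vec v j $ q * cnj (column_vec v i $ q')) * (W p q * cnj (W p q')))"
      unfolding cip_def wW block_act_column cnj_sum sum_product by (simp add: ac_simps)
    also have "\<dots> = (\<Sum>q\<in>UNIV. \<Sum>p\<in>UNIV. \<Sum>q'\<in>UNIV. (column_vec v j $ q * cnj (column_vec v i $ q')) * (W p q * cnj (W p q')))"
      by (rule sum.swap)
    also have "\<dots> = (\<Sum>q\<in>UNIV. \<Sum>q'\<in>UNIV. \<Sum>p\<in>UNIV. (column_vec v j $ q * cnj (column_vec v i $ q')) * (W p q * cnj (W p q')))"
      by (intro sum.cong refl sum.swap)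
    also have "\<dots> = (\<Sum>q\<in>UNIV. \<Sum>q'\<in>UNIV. if q' = q then column_vec v j $ q * cnj (column_vec v i $ q') else 0)"
      unfolding sum_distrib_left[symmetric] W by (intro sum.cong refl) simp
    finally show ?thesis by (simp add: cip_def)
  qed
  with v show ?thesis by (simp add: tuple_space_columns)
qed

text \<open>The complex Householder reflection \<open>1 - u u\<^sup>* / c\<close> with \<open>u = a - b\<close> and
  \<open>c = \<langle>a, u\<rangle>\<close> maps the unit vector \<open>a\<close> to \<open>b\<close> and fixes whatever is orthogonal to \<open>u\<close>.
  When \<open>c = 0\<close>, division by zero makes it the identity, and then \<open>a = b\<close>.\<close>

lemma exists_reflection:
  fixes a b :: "complex ^ ('r::finite \<times> 'k::finite)"
  assumes a: "cip a a = 1" and b: "cip b b = 1"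
  shows "\<exists>w :: complex ^ 'k ^ 'k ^ 'r ^ 'r. block_unitary w \<and>
    (\<forall>(v :: complex ^ 'h ^ 'k ^ 'r) h. column_vec v h = a \<longrightarrow> column_vec (block_act w v) h = b) \<and>
    (\<forall>(v :: complex ^ 'h ^ 'k ^ 'r) h. cip (column_vec v h) a = cip (column_vec v h) b \<longrightarrow>
       column_vec (block_act w v) h = column_vec v h)"
proof -
  define u where "u = a - b"
  define c where "c = cip a u"
  define W where "W p q = (if p = q then 1 else 0) - u $ p * cnj (u $ q) / c" for p q
  have uu: "cip u u = c + cnj c"
    using a b by (simp add: u_def c_def cip_diff_left cip_diff_right cnj_cip)
  then have N: "(\<Sum>p\<in>UNIV. u $ p * cnj (u $ p)) = c + cnj c" by (simp add: cip_def)
  have W: "W = (\<lambda>p q. (if p = q then 1 else 0) - u $ p * cnj (u $ q) / c)"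
    by (simp add: fun_eq_iff W_def)
  have act: "column_vec (block_act (block_matrix W) v) h = column_vec v h - (cip (column_vec v h) u / c) *s u"
    for v :: "complex ^ 'h ^ 'k ^ 'r" and h
  proof -
    have "(\<Sum>q\<in>UNIV. W p q * column_vec v h $ q) = column_vec v h $ p - cip (column_vec v h) u * (u $ p / c)" for p
    proof -
      have "(\<Sum>q\<in>UNIV. W p q * column_vec v h $ q) =
        (\<Sum>q\<in>UNIV. (if p = q then column_vec v h $ q else 0) - (column_vec v h $ q * cnj (u $ q)) * (u $ p / c))"
        by (intro sum.cong refl) (simp add: W_def algebra_simps)
      also have "\<dots> = (\<Sum>q\<in>UNIV. if p = q then column_vec v h $ q else 0) - cip (column_vec v h) u * (u $ p / c)"
        by (simp only: cip_def sum_subtractf sum_distrib_right)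
      finally show ?thesis by simp
    qed
    then show ?thesis
      unfolding vec_eq_iff block_act_column by simp
  qed
  show ?thesis
  proof (intro exI[of _ "block_matrix W"] conjI allI impI)
    show "block_unitary (block_matrix W)"
      unfolding W by (intro block_unitary_matrix reflection_unitary N)
    show "column_vec (block_act (block_matrix W) v) h = b" if "column_vec v h = a"
      for v :: "complex ^ 'h ^ 'k ^ 'r" and h
    proof (cases "c = 0")
      case True
      then have "u = 0" using uu by (simp add: cip_self_eq_0)
      then show ?thesis using that by (simp add: act u_def)
    next
      case False
      then show ?thesis using that by (simp add: act flip: c_def) (simp add: u_def)
    qed
    show "column_vec (block_act (block_matrix W) v) h = column_vec v h"
      if "cip (column_vec v h) a = cip (column_vec v h) b" for v :: "complex ^ 'h ^ 'k ^ 'r" and h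
      using that by (simp add: act u_def cip_diff_right)
  qed
qed

text \<open>Being closed under composition, this allows chains of reflections without multiplying
  block unitaries. Continuity is included because preimages of open sets will form a cover.\<close>

definition measure_symmetry :: "(complex ^ 'h ^ 'k ^ 'r) measure \<Rightarrow> (complex ^ 'h ^ 'k ^ 'r \<Rightarrow> complex ^ 'h ^ 'k ^ 'r) \<Rightarrow> bool" where
  "measure_symmetry \<mu> f \<longleftrightarrow> continuous_on tuple_space f \<and> f ` tuple_space \<subseteq> tuple_space \<and>
     (\<forall>A\<in>sets \<mu>. f -` A \<inter> tuple_space \<in> sets \<mu> \<and> measure \<mu> (f -` A \<inter> tuple_space) = measure \<mu> A)"

lemma measure_symmetry_compose:
  assumes f: "measure_symmetry \<mu> f" and g: "measure_symmetry \<mu> g"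
  shows "measure_symmetry \<mu> (g \<circ> f)"
proof -
  have "continuous_on tuple_space (g \<circ> f)"
    using f g unfolding measure_symmetry_def by (meson continuous_on_compose continuous_on_subset)
  moreover have "(g \<circ> f) ` tuple_space \<subseteq> tuple_space"
    using f g by (auto simp: measure_symmetry_def)
  moreover have "(g \<circ> f) -` A \<inter> tuple_space \<in> sets \<mu> \<and> measure \<mu> ((g \<circ> f) -` A \<inter> tuple_space) = measure \<mu> A"
    if "A \<in> sets \<mu>" for A
  proof -
    have "(g \<circ> f) -` A \<inter> tuple_space = f -` (g -` A \<inter> tuple_space) \<inter> tuple_space"
      using f by (auto simp: measure_symmetry_def)
    then show ?thesis
      using f g that unfolding measure_symmetry_def by metis
  qed
  ultimately show ?thesis by (simp add: measure_symmetry_def)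
qed

lemma continuous_on_block_act: "continuous_on S (block_act w)"
  unfolding block_act_def matrix_matrix_mult_def by (intro continuous_intros)

lemma measure_symmetry_block_act:
  assumes \<mu>: "invariant_prob \<mu>" and w: "block_unitary w"
  shows "measure_symmetry \<mu> (block_act w)"
proof -
  have sp: "space \<mu> = tuple_space" and se: "sets \<mu> = sets (restrict_space borel tuple_space)"
    and inv: "distr \<mu> \<mu> (block_act w) = \<mu>"
    using \<mu> w by (auto simp: invariant_prob_def)
  have "block_act w \<in> measurable (restrict_space borel tuple_space) (restrict_space borel tuple_space)"
    using block_act_tuple_space[OF w]
    by (intro measurable_restrict_space2 borel_measurable_continuous_on_restrict continuous_on_block_act)
      (auto simp: space_restrict_space)
  then have meas: "block_act w \<in> measurable \<mu> \<mu>"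
    using measurable_cong_sets[OF se se] by blast
  have "measure \<mu> (block_act w -` A \<inter> tuple_space) = measure \<mu> A" if "A \<in> sets \<mu>" for A
    using measure_distr[OF meas that] inv sp by simp
  moreover have "block_act w -` A \<inter> tuple_space \<in> sets \<mu>" if "A \<in> sets \<mu>" for A
    using measurable_sets[OF meas that] sp by simp
  ultimately show ?thesis
    using block_act_tuple_space[OF w] continuous_on_block_act by (auto simp: measure_symmetry_def)
qed

text \<open>Align the columns one by one. The reflection moving column h0 into place fixes the
  columns already aligned: each is orthogonal both to the present column h0 and to its target, by
  orthonormality of either tuple.\<close>

lemma measure_symmetry_transitive:
  fixes v v' :: "complex ^ 'h ^ 'k ^ 'r"
  assumes \<mu>: "invariant_prob \<mu>" and v: "v \<in> tuple_space" "v' \<in> tuple_space"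
  obtains f where "measure_symmetry \<mu> f" "f v = v'"
proof -
  have sp: "space \<mu> = tuple_space" using \<mu> by (simp add: invariant_prob_def)
  have "\<exists>f. measure_symmetry \<mu> f \<and> (\<forall>h\<in>A. column_vec (f v) h = column_vec v' h)" for A :: "'h set"
  proof (induction A rule: finite_induct[OF finite])
    case 1
    have "measure_symmetry \<mu> id"
      using sets.sets_into_space[of _ \<mu>] by (auto simp: measure_symmetry_def sp Int_absorb2)
    then show ?case by blast
  next
    case (2 h0 A)
    then obtain f where f: "measure_symmetry \<mu> f" "\<And>h. h \<in> A \<Longrightarrow> column_vec (f v) h = column_vec v' h"
      by blast
    have fv: "f v \<in> tuple_space" using f(1) v(1) by (auto simp: measure_symmetry_def)
    have "cip (column_vec (f v) h0) (column_vec (f v) h0) = 1" "cip (column_vec v' h0) (column_vec v' h0) = 1"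
      using fv v(2) by (simp_all add: tuple_space_columns)
    from exists_reflection[OF this, where 'h = 'h] obtain w :: "complex ^ 'k ^ 'k ^ 'r ^ 'r" where w: "block_unitary w"
      "\<And>(x :: complex ^ 'h ^ 'k ^ 'r) h. column_vec x h = column_vec (f v) h0 \<Longrightarrow> column_vec (block_act w x) h = column_vec v' h0"
      "\<And>(x :: complex ^ 'h ^ 'k ^ 'r) h. cip (column_vec x h) (column_vec (f v) h0) = cip (column_vec x h) (column_vec v' h0) \<Longrightarrow>
         column_vec (block_act w x) h = column_vec x h"
      by blast
    have "measure_symmetry \<mu> (block_act w \<circ> f)"
      by (intro measure_symmetry_compose f(1) measure_symmetry_block_act \<mu> w(1))
    moreover have "column_vec ((block_act w \<circ> f) v) h = column_vec v' h" if "h \<in> insert h0 A" for h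
    proof (cases "h = h0")
      case True
      then show ?thesis using w(2)[of "f v" h0] by simp
    next
      case False
      with that have h: "h \<in> A" by simp
      have "cip (column_vec (f v) h) (column_vec (f v) h0) = 0" "cip (column_vec v' h) (column_vec v' h0) = 0"
        using fv v(2) False by (simp_all add: tuple_space_columns)
      then have "column_vec (block_act w (f v)) h = column_vec (f v) h"
        using f(2)[OF h] by (intro w(3)) simp
      then show ?thesis using f(2)[OF h] by simp
    qed
    ultimately show ?case by blast
  qed
  from this[of UNIV] obtain f where "measure_symmetry \<mu> f" "f v = v'"
    by (auto intro: column_vec_inject)
  then show ?thesis by (rule that)
qed

lemma compact_tuple_space: "compact (tuple_space :: (complex ^ 'h ^ 'k ^ 'r) set)"
proof -
  have "closed (tuple_space :: (complex ^ 'h ^ 'k ^ 'r) set)"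
  proof -
    have eq: "tuple_space = (\<lambda>v :: complex ^ 'h ^ 'k ^ 'r. \<Sum>k\<in>UNIV. adj (v $ k) ** (v $ k)) -` {mat 1}"
      by (auto simp: tuple_space_def)
    have "continuous_on UNIV (\<lambda>v :: complex ^ 'h ^ 'k ^ 'r. \<Sum>k\<in>UNIV. adj (v $ k) ** (v $ k))"
      unfolding adj_def matrix_matrix_mult_def by (intro continuous_intros)
    then show ?thesis
      unfolding eq by (intro continuous_closed_vimage closed_singleton) (simp add: continuous_on_eq_continuous_at)
  qed
  moreover have "bounded (tuple_space :: (complex ^ 'h ^ 'k ^ 'r) set)"
    unfolding bounded_iff
  proof (intro exI ballI)
    fix v :: "complex ^ 'h ^ 'k ^ 'r"
    assume v: "v \<in> tuple_space"
    have "norm (column_vec v h) = 1" for h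
    proof -
      have "cip (column_vec v h) (column_vec v h) = 1" using v by (simp add: tuple_space_columns)
      then show ?thesis unfolding cip_self by (simp add: abs_square_eq_1 flip: of_real_power)
    qed
    then have "cmod (v $ i $ x $ h) \<le> 1" for i x h
      using Finite_Cartesian_Product.norm_nth_le[of "column_vec v h" "(i, x)"] by (simp add: column_vec_def)
    then have "norm (v $ i) \<le> (\<Sum>x\<in>(UNIV :: 'k set). \<Sum>h\<in>(UNIV :: 'h set). 1)" for i
      by (intro order_trans[OF norm_le_sum_entries] sum_mono)
    moreover have "norm v \<le> (\<Sum>i\<in>UNIV. norm (v $ i))"
      unfolding norm_vec_def[of v] by (rule L2_set_le_sum) auto
    ultimately show "norm v \<le> (\<Sum>i\<in>(UNIV :: 'r set). \<Sum>x\<in>(UNIV :: 'k set). \<Sum>h\<in>(UNIV :: 'h set). 1)"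
      by (meson order_trans sum_mono)
  qed
  ultimately show ?thesis by (simp add: compact_eq_bounded_closed)
qed

lemma invariant_prob_open_pos:
  fixes \<mu> :: "(complex ^ 'h ^ 'k ^ 'r) measure"
  assumes \<mu>: "invariant_prob \<mu>" and U: "open U" "v0 \<in> U" "v0 \<in> tuple_space"
  shows "measure \<mu> (U \<inter> tuple_space) > 0"
proof -
  interpret prob_space \<mu> using \<mu> by (simp add: invariant_prob_def)
  have sp: "space \<mu> = tuple_space" and se: "sets \<mu> = sets (restrict_space borel tuple_space)"
    using \<mu> by (auto simp: invariant_prob_def)
  have Um: "U \<inter> tuple_space \<in> sets \<mu>"
    unfolding se sets_restrict_space using U(1) by (auto intro!: image_eqI[of _ _ U])
  have "\<exists>f. measure_symmetry \<mu> f \<and> f v = v0" if "v \<in> tuple_space" for v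
    using measure_symmetry_transitive[OF \<mu> that U(3)] by metis
  then obtain f where f: "\<And>v. v \<in> tuple_space \<Longrightarrow> measure_symmetry \<mu> (f v) \<and> f v v = v0"
    by metis
  \<comment> \<open>The compactness rule takes sets open in the whole space, so each relatively open
    preimage is extended to such a set.\<close>
  have "\<exists>V. open V \<and> V \<inter> tuple_space = f v -` U \<inter> tuple_space" if "v \<in> tuple_space" for v
    using f[OF that] U(1) unfolding measure_symmetry_def continuous_on_open_invariant by blast
  then obtain V where V: "\<And>v. v \<in> tuple_space \<Longrightarrow> open (V v) \<and> V v \<inter> tuple_space = f v -` U \<inter> tuple_space"
    by metis
  have "tuple_space \<subseteq> (\<Union>v\<in>tuple_space. V v)"
    using V f U(2) by blast
  then obtain C where C: "C \<subseteq> tuple_space" "finite C" "tuple_space \<subseteq> (\<Union>v\<in>C. V v)"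
    using compactE_image[OF compact_tuple_space, of tuple_space V] V by metis
  have Vm: "V v \<inter> tuple_space \<in> sets \<mu>" "measure \<mu> (V v \<inter> tuple_space) = measure \<mu> (U \<inter> tuple_space)"
    if "v \<in> tuple_space" for v
  proof -
    have "V v \<inter> tuple_space = f v -` (U \<inter> tuple_space) \<inter> tuple_space"
      using V[OF that] f[OF that] unfolding measure_symmetry_def by blast
    then show "V v \<inter> tuple_space \<in> sets \<mu>" "measure \<mu> (V v \<inter> tuple_space) = measure \<mu> (U \<inter> tuple_space)"
      using f[OF that] Um unfolding measure_symmetry_def by auto
  qed
  have "tuple_space = (\<Union>v\<in>C. V v \<inter> tuple_space)" using C by blast
  then have "1 = measure \<mu> (\<Union>v\<in>C. V v \<inter> tuple_space)"
    using prob_space sp by simp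
  also have "\<dots> \<le> (\<Sum>v\<in>C. measure \<mu> (V v \<inter> tuple_space))"
    using C Vm by (intro finite_measure_subadditive_finite) auto
  also have "\<dots> = card C * measure \<mu> (U \<inter> tuple_space)"
    using C(1) Vm(2) by (simp add: subset_iff)
  finally show ?thesis
    unfolding zero_less_measure_iff by auto
qed

section \<open>Entangled extensions\<close>

lemma openin_entangled:
  "openin (top_of_set (extensions r \<omega>)) {\<rho> \<in> extensions r \<omega>. entangled \<rho>}"
proof -
  have "closed (convex hull (product_densities :: (complex ^ ('a \<times> 'b) ^ ('a \<times> 'b)) set))"
    by (intro compact_imp_closed compact_convex_hull compact_product_densities)
  then have "open (dens -` (- (convex hull (product_densities :: (complex ^ ('a \<times> 'b) ^ ('a \<times> 'b)) set))))"
    using continuous_on_dens by (intro open_vimage) auto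
  moreover have "{\<rho> \<in> extensions r \<omega>. entangled \<rho>} =
      extensions r \<omega> \<inter> dens -` (- (convex hull (product_densities :: (complex ^ ('a \<times> 'b) ^ ('a \<times> 'b)) set)))"
    by (auto simp: entangled_def separable_state_iff extensions_def)
  ultimately show ?thesis by (auto simp: openin_open)
qed

text \<open>One neighbourhood serves both conclusions: the remaining margin is added back for
  separability and excludes a kernel for the rank.\<close>

lemma separable_near:
  fixes d0 :: "complex ^ ('k::finite \<times> 'h::finite) ^ ('k \<times> 'h)"
  assumes "d0 - \<epsilon> *\<^sub>R mat 1 \<in> sepcone" "\<epsilon> > 0" "psd d0"
  shows "\<exists>W. open W \<and> trace_functional d0 \<in> W \<and>
    (\<forall>\<phi>\<in>W. is_state \<phi> \<longrightarrow> separable_state \<phi> \<and> state_rank \<phi> = CARD('k) * CARD('h))"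
proof -
  obtain W where W: "open W" "trace_functional d0 \<in> W"
    "\<And>\<phi>. \<phi> \<in> W \<Longrightarrow> is_state \<phi> \<Longrightarrow> dens \<phi> - (\<epsilon> / 2) *\<^sub>R mat 1 \<in> sepcone"
    using sepcone_nhd[OF assms] by metis
  have "separable_state \<phi> \<and> state_rank \<phi> = CARD('k) * CARD('h)" if "\<phi> \<in> W" "is_state \<phi>" for \<phi>
  proof
    have *: "dens \<phi> - (\<epsilon> / 2) *\<^sub>R mat 1 \<in> sepcone" using W(3) that by blast
    then have "dens \<phi> \<in> sepcone" using assms(2) by (rule sepcone_shift[OF _ less_imp_le[OF half_gt_zero]])
    then have "separable_state (trace_functional (dens \<phi>))"
      using is_stateD(3)[OF that(2)] by (rule separable_state_trace_functional)
    then show "separable_state \<phi>"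
      by (simp flip: is_stateD(1)[OF that(2)])
    show "state_rank \<phi> = CARD('k) * CARD('h)"
      using state_rank_full[OF that(2) *] assms(2) by simp
  qed
  with W(1,2) show ?thesis by blast
qed

lemma open_separable_full_rank:
  "\<exists>U. openin (top_of_set state_space) U \<and> U \<noteq> {} \<and>
     U \<subseteq> {\<rho> :: complex ^ ('m::finite \<times> 'n::finite) ^ ('m \<times> 'n) \<Rightarrow> complex.
            separable_state \<rho> \<and> state_rank \<rho> = CARD('m) * CARD('n)}"
proof -
  define N where "N = real CARD('m \<times> 'n)"
  have N: "N > 0" by (simp add: N_def del: card_prod)
  define d0 :: "complex ^ ('m \<times> 'n) ^ ('m \<times> 'n)" where "d0 = (1 / N) *\<^sub>R mat 1"
  have "d0 \<in> sepcone" using N by (auto simp: d0_def intro: sepcone_scaleR mat1_sepcone)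
  then have d0: "psd d0" by (rule sepcone_psd)
  have "trace d0 = 1"
    using N unfolding d0_def trace_scaleR trace_I N_def
    by (metis of_real_mult of_real_of_nat_eq of_real_1 nonzero_eq_divide_eq less_irrefl)
  then have st: "is_state (trace_functional d0)" using d0 by (rule is_state_trace_functional[rotated])
  \<comment> \<open>The tracial density is its own margin; what remains is the apex of the
    cone.\<close>
  have near: "d0 - (1 / N) *\<^sub>R mat 1 \<in> sepcone" "1 / N > 0"
    using N by (simp_all add: d0_def sepcone_0)
  obtain W where W: "open W" "trace_functional d0 \<in> W"
    "\<And>\<phi>. \<phi> \<in> W \<Longrightarrow> is_state \<phi> \<Longrightarrow> separable_state \<phi> \<and> state_rank \<phi> = CARD('m) * CARD('n)"
    using separable_near[OF near d0] by blast
  show ?thesis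
    using W st by (intro exI[of _ "state_space \<inter> W"]) (auto simp: openin_open state_space_def)
qed

lemma exists_rho_separable_nhd:
  fixes \<omega> :: "complex ^ 'h ^ 'h \<Rightarrow> complex"
  assumes \<omega>: "is_state \<omega>" "faithful \<omega>" "represents \<xi> \<omega>"
    and card: "CARD('r::finite) = CARD('k) * CARD('h)"
  shows "\<exists>(v :: complex ^ 'h ^ 'k ^ 'r) W. v \<in> tuple_space \<and> open W \<and> rho \<xi> v \<in> W \<and>
    (\<forall>\<phi>\<in>W. is_state \<phi> \<longrightarrow> separable_state \<phi>)"
proof -
  obtain v :: "complex ^ 'h ^ 'k ^ 'r" and \<epsilon> where v: "v \<in> tuple_space" "\<epsilon> > 0"
    "dens (rho \<xi> v) - \<epsilon> *\<^sub>R mat 1 \<in> sepcone"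
    using exists_rho_separable_interior[OF \<omega> card] .
  have st: "is_state (rho \<xi> v)"
    using rho_extensions[OF \<omega>(1,3) v(1)] by (simp add: extensions_def)
  obtain W where W: "open W" "trace_functional (dens (rho \<xi> v)) \<in> W"
    "\<And>\<phi>. \<phi> \<in> W \<Longrightarrow> is_state \<phi> \<Longrightarrow> separable_state \<phi>"
    using separable_near[OF v(3,2) is_stateD(2)[OF st]] by blast
  moreover have "rho \<xi> v \<in> W" using W(2) by (simp flip: is_stateD(1)[OF st])
  ultimately show ?thesis using v(1) by blast
qed

section \<open>Probabilities of open sets of extensions\<close>

lemma continuous_on_rho: "continuous_on S (rho \<xi>)"
proof (rule continuous_on_coordinatewise_then_product)
  fix x
  have *: "continuous_on S (\<lambda>v. (v $ k \<otimes> mat 1) *v \<xi>)" for k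
    unfolding otimes_def by (intro continuous_on_matrix_vector_mult continuous_intros)
  show "continuous_on S (\<lambda>v. rho \<xi> v x)"
    unfolding rho_def
    by (intro continuous_on_sum continuous_on_cip[OF continuous_on_matrix_vector_mult[OF continuous_on_const *] *])
qed

lemma measure_P_ext:
  fixes \<mu> :: "(complex ^ 'h ^ 'k ^ 'r) measure"
  assumes \<omega>: "is_state \<omega>" "represents \<xi> \<omega>" and \<mu>: "invariant_prob \<mu>"
    and card: "CARD('r) = CARD('k) * CARD('h)" and G: "open G"
  shows "measure (P_ext \<mu> \<xi> \<omega>) (extensions CARD('r) \<omega> \<inter> G) = measure \<mu> (rho \<xi> -` G \<inter> tuple_space)"
proof -
  have sp: "space \<mu> = tuple_space" and se: "sets \<mu> = sets (restrict_space borel tuple_space)"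
    using \<mu> by (auto simp: invariant_prob_def)
  have ext: "rho \<xi> v \<in> extensions CARD('r) \<omega>" if "v \<in> tuple_space" for v :: "complex ^ 'h ^ 'k ^ 'r"
    using rho_extensions[OF \<omega> that] card by simp
  let ?N = "restrict_space borel (extensions CARD('r) \<omega>)
    :: (complex ^ ('k \<times> 'h) ^ ('k \<times> 'h) \<Rightarrow> complex) measure"
  have "rho \<xi> \<in> measurable (restrict_space borel (tuple_space :: (complex ^ 'h ^ 'k ^ 'r) set)) ?N"
    using ext
    by (intro measurable_restrict_space2 borel_measurable_continuous_on_restrict continuous_on_rho)
      (auto simp: space_restrict_space)
  then have meas: "rho \<xi> \<in> measurable \<mu> ?N"
    using measurable_cong_sets[OF se refl] by blast
  have S: "extensions CARD('r) \<omega> \<inter> G \<in> sets ?N"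
    unfolding sets_restrict_space using G by auto
  have "measure (P_ext \<mu> \<xi> \<omega>) (extensions CARD('r) \<omega> \<inter> G) =
      measure \<mu> (rho \<xi> -` (extensions CARD('r) \<omega> \<inter> G) \<inter> space \<mu>)"
    unfolding P_ext_def using meas S by (rule measure_distr)
  also have "rho \<xi> -` (extensions CARD('r) \<omega> \<inter> G) \<inter> space \<mu> = rho \<xi> -` G \<inter> tuple_space"
    using ext sp by auto
  finally show ?thesis .
qed

lemma P_ext_open_pos:
  fixes \<mu> :: "(complex ^ 'h ^ 'k ^ 'r) measure" and v :: "complex ^ 'h ^ 'k ^ 'r"
  assumes \<omega>: "is_state \<omega>" "represents \<xi> \<omega>" and \<mu>: "invariant_prob \<mu>"
    and card: "CARD('r) = CARD('k) * CARD('h)" and G: "open G"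
    and v: "v \<in> tuple_space" "rho \<xi> v \<in> G"
  shows "measure (P_ext \<mu> \<xi> \<omega>) (extensions CARD('r) \<omega> \<inter> G) > 0"
proof -
  have "open (rho \<xi> -` G :: (complex ^ 'h ^ 'k ^ 'r) set)"
    using G continuous_on_rho by (rule open_vimage)
  then show ?thesis
    unfolding measure_P_ext[OF \<omega> \<mu> card G]
    using v by (intro invariant_prob_open_pos[OF \<mu>, of _ v]) auto
qed

text \<open>The tuples sent into W form a set of positive measure that is disjoint from those sent
  into G, so they take a positive share of the total mass 1.\<close>

lemma P_ext_disjoint_lt_1:
  fixes \<mu> :: "(complex ^ 'h ^ 'k ^ 'r) measure" and v :: "complex ^ 'h ^ 'k ^ 'r"
  assumes \<omega>: "is_state \<omega>" "represents \<xi> \<omega>" and \<mu>: "invariant_prob \<mu>"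
    and card: "CARD('r) = CARD('k) * CARD('h)" and G: "open G" "open W"
    and disj: "extensions CARD('r) \<omega> \<inter> G \<inter> W = {}"
    and v: "v \<in> tuple_space" "rho \<xi> v \<in> W"
  shows "measure (P_ext \<mu> \<xi> \<omega>) (extensions CARD('r) \<omega> \<inter> G) < 1"
proof -
  interpret prob_space \<mu> using \<mu> by (simp add: invariant_prob_def)
  have sp: "space \<mu> = tuple_space" and se: "sets \<mu> = sets (restrict_space borel tuple_space)"
    using \<mu> by (auto simp: invariant_prob_def)
  have op: "open (rho \<xi> -` X :: (complex ^ 'h ^ 'k ^ 'r) set)" if "open X" for X
    using that continuous_on_rho by (rule open_vimage)
  have sets: "rho \<xi> -` X \<inter> tuple_space \<in> sets \<mu>" if "open X" for X
    unfolding se sets_restrict_space using op[OF that] by auto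
  have "(rho \<xi> -` G \<inter> tuple_space) \<inter> (rho \<xi> -` W \<inter> tuple_space) = {}"
    using rho_extensions[OF \<omega>] disj card by fastforce
  then have "prob (rho \<xi> -` G \<inter> tuple_space) + prob (rho \<xi> -` W \<inter> tuple_space) =
      prob ((rho \<xi> -` G \<inter> tuple_space) \<union> (rho \<xi> -` W \<inter> tuple_space))"
    using sets G by (intro finite_measure_Union[symmetric])
  also have "\<dots> \<le> 1" by (rule prob_le_1)
  finally have "prob (rho \<xi> -` G \<inter> tuple_space) + prob (rho \<xi> -` W \<inter> tuple_space) \<le> 1" .
  moreover have "prob (rho \<xi> -` W \<inter> tuple_space) > 0"
    using v op[OF G(2)] by (intro invariant_prob_open_pos[OF \<mu>, of _ v]) auto
  ultimately show ?thesis
    unfolding measure_P_ext[OF \<omega> \<mu> card G(1)] by linarith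
qed

theorem theorem10p1:
  assumes "CARD('n::finite) \<le> CARD('m::finite)"
  shows "(\<exists>U. openin (top_of_set state_space) U \<and> U \<noteq> {} \<and>
            U \<subseteq> {\<rho> :: complex ^ ('m \<times> 'n) ^ ('m \<times> 'n) \<Rightarrow> complex.
                   separable_state \<rho> \<and> state_rank \<rho> = CARD('m) * CARD('n)}) \<and>
         (CARD('n) \<ge> 2 \<longrightarrow>
           (\<forall>\<omega> :: complex ^ 'n ^ 'n \<Rightarrow> complex. is_state \<omega> \<and> faithful \<omega> \<longrightarrow>
             (let E = (extensions (CARD('m) * CARD('n)) \<omega>
                         :: (complex ^ ('m \<times> 'n) ^ ('m \<times> 'n) \<Rightarrow> complex) set);
                  S = {\<rho> \<in> E. entangled \<rho>}
              in openin (top_of_set E) S \<and> S \<noteq> {} \<and> (top_of_set E) closure_of S \<noteq> E \<and>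
                 (\<forall>(\<mu> :: (complex ^ 'n ^ 'm ^ 'r::finite) measure) \<xi>.
                    CARD('r) = CARD('m) * CARD('n) \<and> invariant_prob \<mu> \<and> represents \<xi> \<omega> \<longrightarrow>
                    0 < measure (P_ext \<mu> \<xi> \<omega>) S \<and> measure (P_ext \<mu> \<xi> \<omega>) S < 1))))"
proof (intro conjI impI allI open_separable_full_rank)
  fix \<omega> :: "complex ^ 'n ^ 'n \<Rightarrow> complex"
  assume n2: "CARD('n) \<ge> 2" and "is_state \<omega> \<and> faithful \<omega>"
  then have \<omega>: "is_state \<omega>" "faithful \<omega>" by auto
  define E :: "(complex ^ ('m \<times> 'n) ^ ('m \<times> 'n) \<Rightarrow> complex) set"
    where "E = extensions (CARD('m) * CARD('n)) \<omega>"
  define S where "S = {\<rho> \<in> E. entangled \<rho>}"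
  have opS: "openin (top_of_set E) S"
    unfolding S_def E_def by (rule openin_entangled)
  then obtain G where G: "open G" "S = E \<inter> G" by (auto simp: openin_open)
  obtain \<xi>0 where \<xi>0: "represents \<xi>0 \<omega>" using exists_represents[OF \<omega>] .
  \<comment> \<open>The topological claims carry no condition on the size of \<open>'r\<close>.
    Their witnesses are therefore tuples indexed by \<open>'m \<times> 'n\<close>, a type that has
    the right cardinality.\<close>
  have in_E: "rho \<xi> v \<in> E" if "represents \<xi> \<omega>" "v \<in> tuple_space" for \<xi> and v :: "complex ^ 'n ^ 'm ^ ('m \<times> 'n)"
    unfolding E_def using rho_extensions[OF \<omega>(1) that] .
  have "S \<noteq> {}"
  proof -
    obtain v :: "complex ^ 'n ^ 'm ^ ('m \<times> 'n)" where "v \<in> tuple_space" "entangled (rho \<xi>0 v)"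
      using exists_rho_entangled[OF \<omega>(1) \<xi>0 assms n2] .
    then show ?thesis using in_E[OF \<xi>0] by (auto simp: S_def)
  qed
  moreover have "(top_of_set E) closure_of S \<noteq> E"
  proof -
    obtain v :: "complex ^ 'n ^ 'm ^ ('m \<times> 'n)" and W where v: "v \<in> tuple_space" "open W" "rho \<xi>0 v \<in> W"
      "\<forall>\<phi>\<in>W. is_state \<phi> \<longrightarrow> separable_state \<phi>"
      using exists_rho_separable_nhd[OF \<omega> \<xi>0, where 'r = "'m \<times> 'n" and 'k = 'm] by auto
    have "S \<inter> W = {}" using v(4) by (auto simp: S_def entangled_def)
    have "openin (top_of_set E) (E \<inter> W)" using v(2) by (rule openin_open_Int)
    then have "(E \<inter> W) \<inter> (top_of_set E) closure_of S = {}"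
      using \<open>S \<inter> W = {}\<close> by (subst openin_Int_closure_of_eq_empty) auto
    then show ?thesis using in_E[OF \<xi>0 v(1)] v(3) by blast
  qed
  moreover have "0 < measure (P_ext \<mu> \<xi> \<omega>) S \<and> measure (P_ext \<mu> \<xi> \<omega>) S < 1"
    if "CARD('r) = CARD('m) * CARD('n) \<and> invariant_prob \<mu> \<and> represents \<xi> \<omega>"
    for \<mu> :: "(complex ^ 'n ^ 'm ^ 'r) measure" and \<xi>
  proof -
    from that have card: "CARD('r) = CARD('m) * CARD('n)" and \<mu>: "invariant_prob \<mu>" and \<xi>: "represents \<xi> \<omega>"
      by auto
    have S: "S = extensions CARD('r) \<omega> \<inter> G" using G(2) card by (simp add: E_def)
    obtain v :: "complex ^ 'n ^ 'm ^ 'r" where v: "v \<in> tuple_space" "entangled (rho \<xi> v)"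
      using exists_rho_entangled[OF \<omega>(1) \<xi> assms n2] .
    then have "rho \<xi> v \<in> S"
      using rho_extensions[OF \<omega>(1) \<xi> v(1)] by (simp add: S_def E_def)
    then have pos: "measure (P_ext \<mu> \<xi> \<omega>) S > 0"
      unfolding S using v(1) by (intro P_ext_open_pos[OF \<omega>(1) \<xi> \<mu> card G(1)]) auto
    obtain v' :: "complex ^ 'n ^ 'm ^ 'r" and W where v': "v' \<in> tuple_space" "open W" "rho \<xi> v' \<in> W"
      "\<forall>\<phi>\<in>W. is_state \<phi> \<longrightarrow> separable_state \<phi>"
      using exists_rho_separable_nhd[OF \<omega> \<xi> card] by blast
    have "S \<inter> W = {}" using v'(4) by (auto simp: S_def entangled_def)
    then have "measure (P_ext \<mu> \<xi> \<omega>) S < 1"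
      unfolding S using v'(1-3) by (intro P_ext_disjoint_lt_1[OF \<omega>(1) \<xi> \<mu> card G(1)]) auto
    with pos show ?thesis by simp
  qed
  ultimately show "let E = extensions (CARD('m) * CARD('n)) \<omega> :: (complex ^ ('m \<times> 'n) ^ ('m \<times> 'n) \<Rightarrow> complex) set;
      S = {\<rho> \<in> E. entangled \<rho>}
    in openin (top_of_set E) S \<and> S \<noteq> {} \<and> (top_of_set E) closure_of S \<noteq> E \<and>
       (\<forall>(\<mu> :: (complex ^ 'n ^ 'm ^ 'r) measure) \<xi>.
          CARD('r) = CARD('m) * CARD('n) \<and> invariant_prob \<mu> \<and> represents \<xi> \<omega> \<longrightarrow>
          0 < measure (P_ext \<mu> \<xi> \<omega>) S \<and> measure (P_ext \<mu> \<xi> \<omega>) S < 1)"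
    using opS unfolding Let_def E_def[symmetric] S_def[symmetric] by blast
qed

end
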